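(* Let $d=(d_n)_{n\ge0}$ be a monotonic increasing, unbounded sequence of positive real numbers such that $\lim_{n\to\infty}\frac{d_{n+1}}{d_n}=r$ for some real number $r$. Let $a=(a_n)_{n\ge0}$ be a complex sequence with $a_0\ne0$, $a_1\neq0$ such that $T_a$ is a bounded linear operator on $h_d$ and such that the power series $\Phi_a(z)=\sum_{n=0}^\infty a_nz^n$ is analytic on some neighbourhood of $\overline{\mathbb D}_r$. Then: (i) If $r=1$, then $$\sigma_c(T_a,h_d)=\begin{cases}\emptyset, & \text{if } \sup_n\frac{n+1}{d_n}<\infty,\\ \Phi_a(\overline{\mathbb D})\setminus\Phi_a(\overline{\mathbb D}\setminus\{1\}), & \text{if } \sup_n\frac{n+1}{d_n}=\infty.\end{cases}$$ (ii) If $r>1$, then $$\sigma_c(T_a,h_d)=\begin{cases}\emptyset, & \text{if } \sup_n\frac{r^n}{d_n}<\infty,\\ \Phi_a(\overline{\mathbb D}_r)\setminus\Phi_a(\mathbb D_r), & \text{if } \sup_n\frac{r^n}{d_n}=\infty.\end{cases}$$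
   Context: All sequences are complex and indexed by $\mathbb N_0=\{0,1,2,\dots\}$. The weighted Hahn space is $h_d=\{x\in\mathbb C^{\mathbb N_0}:\sum_{n=0}^\infty d_n|x_n-x_{n+1}|<\infty,\ \lim_n x_n=0\}$ with norm $\|x\|_{h_d}=\sum_{n=0}^\infty d_n|x_n-x_{n+1}|$; it is a Banach space. The convolution is $(a*x)_n=\sum_{k=0}^n a_{n-k}x_k$, and $T_a(x)=a*x$. $\mathbb D_r$ is the open disk in $\mathbb C$ centered at $0$ of radius $r$, $\overline{\mathbb D}_r$ its closure, $\mathbb D=\mathbb D_1$. $\Phi_a$ being analytic on a neighbourhood of $\overline{\mathbb D}_r$ means the power series converges there to an analytic function. For $T\in\mathcal B(X)$, the continuous spectrum $\sigma_c(T,X)$ is the set of $\lambda\in\mathbb C$ such that $T-\lambda I$ is injective, its range is dense in $X$, and its range is not equal to $X$. *)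

theory Defs
  imports "HOL-Analysis.Analysis"
begin

definition hahn_space :: "(nat \<Rightarrow> real) \<Rightarrow> (nat \<Rightarrow> complex) set" where
  "hahn_space d = {x. summable (\<lambda>n. d n * cmod (x n - x (Suc n))) \<and> x \<longlonglongrightarrow> 0}"

definition hahn_norm :: "(nat \<Rightarrow> real) \<Rightarrow> (nat \<Rightarrow> complex) \<Rightarrow> real" where
  "hahn_norm d x = (\<Sum>n. d n * cmod (x n - x (Suc n)))"

definition conv_op :: "(nat \<Rightarrow> complex) \<Rightarrow> (nat \<Rightarrow> complex) \<Rightarrow> nat \<Rightarrow> complex" where
  "conv_op a x = (\<lambda>n. \<Sum>k=0..n. a (n - k) * x k)"

definition gen_fun :: "(nat \<Rightarrow> complex) \<Rightarrow> complex \<Rightarrow> complex" where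
  "gen_fun a z = (\<Sum>n. a n * z ^ n)"

(* suminf has a junk value where the series diverges, so convergence on the
   neighbourhood is required separately. *)
definition gen_fun_analytic_near :: "(nat \<Rightarrow> complex) \<Rightarrow> complex set \<Rightarrow> bool" where
  "gen_fun_analytic_near a K \<longleftrightarrow>
     (\<exists>U. open U \<and> K \<subseteq> U \<and> (\<forall>z\<in>U. summable (\<lambda>n. a n * z ^ n)) \<and> gen_fun a analytic_on U)"

(* The Hahn space depends on the sequence d and hence is not a type, so the operator notions
   are stated for a linear space X of complex sequences (with pointwise operations) and a
   norm N on X. Operators are total functions, of which only the values on X matter. *)

definition bounded_operator_on ::
  "(nat \<Rightarrow> complex) set \<Rightarrow> ((nat \<Rightarrow> complex) \<Rightarrow> real) \<Rightarrow>
   ((nat \<Rightarrow> complex) \<Rightarrow> nat \<Rightarrow> complex) \<Rightarrow> bool" where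
  "bounded_operator_on X N T \<longleftrightarrow>
     (\<forall>x\<in>X. T x \<in> X) \<and>
     (\<forall>x\<in>X. \<forall>y\<in>X. T (\<lambda>n. x n + y n) = (\<lambda>n. T x n + T y n)) \<and>
     (\<forall>c. \<forall>x\<in>X. T (\<lambda>n. c * x n) = (\<lambda>n. c * T x n)) \<and>
     (\<exists>C. \<forall>x\<in>X. N (T x) \<le> C * N x)"

definition shifted_op ::
  "((nat \<Rightarrow> complex) \<Rightarrow> nat \<Rightarrow> complex) \<Rightarrow> complex \<Rightarrow>
   (nat \<Rightarrow> complex) \<Rightarrow> nat \<Rightarrow> complex" where
  "shifted_op T c x = (\<lambda>n. T x n - c * x n)"

definition dense_in ::
  "(nat \<Rightarrow> complex) set \<Rightarrow> ((nat \<Rightarrow> complex) \<Rightarrow> real) \<Rightarrow> (nat \<Rightarrow> complex) set \<Rightarrow> bool" where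
  "dense_in X N Y \<longleftrightarrow> Y \<subseteq> X \<and> (\<forall>x\<in>X. \<forall>e>0. \<exists>y\<in>Y. N (\<lambda>n. x n - y n) < e)"

definition continuous_spectrum ::
  "(nat \<Rightarrow> complex) set \<Rightarrow> ((nat \<Rightarrow> complex) \<Rightarrow> real) \<Rightarrow>
   ((nat \<Rightarrow> complex) \<Rightarrow> nat \<Rightarrow> complex) \<Rightarrow> complex set" where
  "continuous_spectrum X N T =
     {c. inj_on (shifted_op T c) X \<and>
         dense_in X N (shifted_op T c ` X) \<and>
         shifted_op T c ` X \<noteq> X}"

end

theory Submission
  imports Defs "HOL-Complex_Analysis.Complex_Analysis"
begin

text \<open>
  Identify a sequence with its generating function, so that \<open>T\<^sub>a - c\<close> becomes multiplication by the
  power series \<open>B = \<Phi>\<^sub>a - c\<close>, which is injective because \<open>a\<^sub>1 \<noteq> 0\<close>. Power series of radius of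
  convergence greater than \<open>r\<close> act boundedly on the Hahn space, so if \<open>B\<close> has no zero in the closed
  disc, multiplication by \<open>1/B\<close> shows that \<open>B\<close> is onto. By summation by parts, evaluation at \<open>z\<close>
  is a continuous functional as soon as the sums \<open>1 + z + \<dots> + z\<^sup>n\<close> are \<open>O(d\<^sub>n)\<close>; call such \<open>z\<close>
  regular. A regular zero of \<open>B\<close> prevents the range from being dense. If \<open>z\<close> is not
  regular, the polynomials \<open>(1 + X + \<dots> + X\<^sup>n) / (1 + z + \<dots> + z\<^sup>n)\<close> have norm
  \<open>d\<^sub>n / |1 + z + \<dots> + z\<^sup>n|\<close>, which is arbitrarily small along some \<open>n\<close>, and differ from \<open>1\<close> by a
  multiple of \<open>X - z\<close>; hence \<open>X - z\<close> has dense range, and splitting off zeros one after the other so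
  does every \<open>B\<close> all of whose zeros are irregular. At an irregular point of the closed disc,
  \<open>X - z\<close> is not onto: this is the failure of a weighted Hardy inequality for slowly varying weights.
\<close>

section \<open>Slowly varying weights\<close>

text \<open>Place the masses 1/(j+1)^2 on a sparse set of indices \<open>g j\<close> at which
  \<open>L\<close> is at least (j+1)^2: the masses are summable, but infinitely many products are at
  least 1.\<close>

lemma exists_summable_not_summable_mult:
  fixes L :: "nat \<Rightarrow> real"
  assumes "filterlim L at_top sequentially"
  obtains \<sigma> :: "nat \<Rightarrow> real"
  where "\<And>n. 0 \<le> \<sigma> n" "summable \<sigma>" "\<not> summable (\<lambda>n. \<sigma> n * L n)"
proof -
  have ev: "\<forall>\<^sub>F n in sequentially. Z \<le> L n" for Z
    using assms by (auto simp: filterlim_at_top)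
  have "\<exists>g. \<forall>j. real ((Suc j)\<^sup>2) \<le> L (g j) \<and> g j < g (Suc j)"
  proof (rule dependent_nat_choice)
    show "\<exists>n. real ((Suc 0)\<^sup>2) \<le> L n"
      using ev eventually_happens trivial_limit_sequentially by blast
    show "\<exists>n'. real ((Suc (Suc j))\<^sup>2) \<le> L n' \<and> n < n'" for n j
      using eventually_conj[OF ev[of "real ((Suc (Suc j))\<^sup>2)"] eventually_gt_at_top[of n]]
        eventually_happens trivial_limit_sequentially by blast
  qed
  then obtain g where g: "\<And>j. real ((Suc j)\<^sup>2) \<le> L (g j)" "\<And>j. g j < g (Suc j)" by blast
  have mono: "strict_mono g" using g by (simp add: strict_mono_Suc_iff)
  hence inj: "inj g" by (rule strict_mono_imp_inj_on)
  define \<sigma> where "\<sigma> n = (if n \<in> range g then 1 / real ((Suc (inv g n))\<^sup>2) else 0)" for n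
  have \<sigma>g: "\<sigma> (g j) = 1 / real ((Suc j)\<^sup>2)" for j by (simp add: \<sigma>_def inj)
  have "summable (\<lambda>j. \<sigma> (g j))"
    unfolding \<sigma>g using inverse_power_summable[of 2, where 'a=real, THEN summable_Suc_iff[THEN iffD2]]
    by (simp add: field_simps)
  hence "summable \<sigma>" by (subst (asm) summable_mono_reindex[OF mono]) (auto simp: \<sigma>_def)
  moreover have "\<not> summable (\<lambda>n. \<sigma> n * L n)"
  proof
    assume "summable (\<lambda>n. \<sigma> n * L n)"
    hence "summable (\<lambda>j. \<sigma> (g j) * L (g j))"
      by (subst summable_mono_reindex[OF mono, of "\<lambda>n. \<sigma> n * L n"]) (auto simp: \<sigma>_def)
    hence "(\<lambda>j. \<sigma> (g j) * L (g j)) \<longlonglongrightarrow> 0" by (rule summable_LIMSEQ_zero)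
    moreover have "1 \<le> \<sigma> (g j) * L (g j)" for j
      unfolding \<sigma>g using g(1)[of j] by (simp add: field_simps del: of_nat_Suc of_nat_power)
    ultimately have "(1::real) \<le> 0" by (intro LIMSEQ_le_const) auto
    thus False by simp
  qed
  moreover have "0 \<le> \<sigma> n" for n by (simp add: \<sigma>_def)
  ultimately show ?thesis using that by blast
qed

context
  fixes w :: "nat \<Rightarrow> real"
  assumes w_pos: "\<And>n. w n > 0" and w_ratio: "(\<lambda>n. w (Suc n) / w n) \<longlonglongrightarrow> 1"
begin

lemma shift_ratio: "(\<lambda>k. w (k + j) / w k) \<longlonglongrightarrow> 1"
proof (induction j)
  case 0
  have "w k \<noteq> 0" for k using w_pos[of k] by simp
  thus ?case by simp
next
  case (Suc j)
  have "(\<lambda>k. w (Suc (k + j)) / w (k + j) * (w (k + j) / w k)) \<longlonglongrightarrow> 1 * 1"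
    using Suc LIMSEQ_ignore_initial_segment[OF w_ratio, of j] by (intro tendsto_mult) auto
  moreover have "w (Suc (k + j)) / w (k + j) * (w (k + j) / w k) = w (k + Suc j) / w k" for k
    using w_pos[of "k + j"] by simp
  ultimately show ?case by (simp only: mult_1)
qed

text \<open>For fixed \<open>m\<close>, the \<open>m\<close> terms just before
  \<open>w (k + m)\<close> are all asymptotic to it, so they alone push the quotient towards
  \<open>m\<close>, which is arbitrary.\<close>

lemma filterlim_partial_sum_ratio: "filterlim (\<lambda>k. (\<Sum>n<k. w n) / w k) at_top sequentially"
  unfolding filterlim_at_top
proof
  fix Z :: real
  obtain m where m: "Z < real m" using reals_Archimedean2 by blast
  have "(\<lambda>k. \<Sum>j<m. (w (k + j) / w k) / (w (k + m) / w k)) \<longlonglongrightarrow> (\<Sum>j<m. 1 / 1)"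
    by (intro tendsto_sum tendsto_divide shift_ratio) auto
  hence "(\<lambda>k. \<Sum>j<m. (w (k + j) / w k) / (w (k + m) / w k)) \<longlonglongrightarrow> real m" by simp
  hence "\<forall>\<^sub>F k in sequentially. Z < (\<Sum>j<m. (w (k + j) / w k) / (w (k + m) / w k))"
    using m by (rule order_tendstoD)
  hence "\<forall>\<^sub>F k in sequentially. Z \<le> (\<Sum>n<k + m. w n) / w (k + m)"
  proof eventually_elim
    case (elim k)
    have "(\<Sum>j<m. (w (k + j) / w k) / (w (k + m) / w k)) = (\<Sum>j<m. w (k + j)) / w (k + m)"
      using w_pos[of k] by (simp add: sum_divide_distrib)
    also have "\<dots> \<le> (\<Sum>n<k + m. w n) / w (k + m)"
    proof (rule divide_right_mono)
      have "(\<Sum>j<m. w (k + j)) = (\<Sum>n\<in>(+) k ` {..<m}. w n)" by (simp add: sum.reindex)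
      also have "\<dots> \<le> (\<Sum>n<k + m. w n)"
        using w_pos by (intro sum_mono2) (auto intro: less_imp_le)
      finally show "(\<Sum>j<m. w (k + j)) \<le> (\<Sum>n<k + m. w n)" .
    qed (use w_pos[of "k + m"] in simp)
    finally show ?case using elim by simp
  qed
  thus "\<forall>\<^sub>F k in sequentially. Z \<le> (\<Sum>n<k. w n) / w k"
    by (subst (asm) eventually_sequentially_seg)
qed

text \<open>The \<open>m\<close> terms from index \<open>k\<close> on are each asymptotic to
  \<open>w k\<close>, so the quotient eventually exceeds every number below
  \<open>m\<close>.\<close>

lemma filterlim_tail_ratio:
  assumes "summable w"
  shows "filterlim (\<lambda>k. (\<Sum>n. w (n + k)) / w k) at_top sequentially"
  unfolding filterlim_at_top
proof
  fix Z :: real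
  obtain m where m: "Z < real m" using reals_Archimedean2 by blast
  have "(\<lambda>k. \<Sum>j<m. w (k + j) / w k) \<longlonglongrightarrow> (\<Sum>j<m. 1)"
    by (intro tendsto_sum shift_ratio)
  hence "(\<lambda>k. \<Sum>j<m. w (k + j) / w k) \<longlonglongrightarrow> real m" by simp
  hence "\<forall>\<^sub>F k in sequentially. Z < (\<Sum>j<m. w (k + j) / w k)"
    using m by (rule order_tendstoD)
  thus "\<forall>\<^sub>F k in sequentially. Z \<le> (\<Sum>n. w (n + k)) / w k"
  proof eventually_elim
    case (elim k)
    have "(\<Sum>j<m. w (j + k)) \<le> (\<Sum>n. w (n + k))"
      using w_pos summable_ignore_initial_segment[OF assms, of k]
      by (intro sum_le_suminf) (auto intro: less_imp_le)
    hence "(\<Sum>j<m. w (j + k)) / w k \<le> (\<Sum>n. w (n + k)) / w k"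
      using w_pos[of k] by (intro divide_right_mono) auto
    thus ?case using elim by (simp add: sum_divide_distrib add.commute)
  qed
qed

text \<open>After interchanging the summations, the last series is the sum of \<open>w n\<close>
  times the tail of \<open>y\<close> beyond \<open>n\<close>; so the weighted norm of a sequence
  does not control that of its tail sums.\<close>

lemma tail_Hardy_fails:
  obtains y :: "nat \<Rightarrow> real" where "\<And>n. 0 \<le> y n" "summable (\<lambda>n. w n * y n)"
    "\<not> summable (\<lambda>k. y k * (\<Sum>n<k. w n))"
proof -
  obtain \<sigma> :: "nat \<Rightarrow> real" where \<sigma>: "\<And>n. 0 \<le> \<sigma> n" "summable \<sigma>"
    "\<not> summable (\<lambda>n. \<sigma> n * ((\<Sum>j<n. w j) / w n))"
    using exists_summable_not_summable_mult[OF filterlim_partial_sum_ratio] by blast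
  have "w n * (\<sigma> n / w n) = \<sigma> n" for n using w_pos[of n] by simp
  with \<sigma> w_pos that[of "\<lambda>n. \<sigma> n / w n"] show ?thesis
    by (simp add: less_imp_le)
qed

text \<open>The dual statement, for partial sums instead of tails. If \<open>w\<close> is not
  summable, a unit mass at 0 suffices; otherwise interchanging the summations brings in the tails
  \<open>W\<close> of \<open>w\<close>, which outgrow \<open>w\<close> itself.\<close>

lemma head_Hardy_fails:
  obtains s :: "nat \<Rightarrow> real" where "\<And>n. 0 \<le> s n" "summable (\<lambda>n. w n * s n)"
    "\<not> summable (\<lambda>n. w n * (\<Sum>k\<le>n. s k))"
proof (cases "summable w")
  case False
  have "summable (\<lambda>n. w n * (if n = 0 then 1 else 0))"
    by (rule summable_finite[of "{0}"]) auto
  moreover have "(\<Sum>k\<le>n. if k = 0 then 1 else 0) = (1::real)" for n :: nat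
    by (induction n) auto
  ultimately show ?thesis using False that[of "\<lambda>n. if n = 0 then 1 else 0"] by simp
next
  case True
  define W where "W k = (\<Sum>n. w (n + k))" for k
  have W_Suc: "W k = w k + W (Suc k)" for k
    using suminf_split_head[OF summable_ignore_initial_segment[OF True, of k]] by (simp add: W_def)
  obtain \<sigma> :: "nat \<Rightarrow> real" where \<sigma>: "\<And>n. 0 \<le> \<sigma> n" "summable \<sigma>"
    "\<not> summable (\<lambda>n. \<sigma> n * (W n / w n))"
    unfolding W_def using exists_summable_not_summable_mult[OF filterlim_tail_ratio[OF True]] by blast
  define s where "s n = \<sigma> n / w n" for n
  define t where "t n = (\<Sum>k\<le>n. s k)" for n
  have s0: "0 \<le> s n" for n using \<sigma> w_pos[of n] by (simp add: s_def)
  have t_mono: "t m \<le> t n" if "m \<le> n" for m n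
    unfolding t_def using that s0 by (intro sum_mono2) auto
  have t0: "0 \<le> t n" for n unfolding t_def using s0 by (simp add: sum_nonneg)
  have "\<not> summable (\<lambda>n. w n * t n)"
  proof
    assume S: "summable (\<lambda>n. w n * t n)"
    \<comment> \<open>Summation by parts: \<open>w k\<close> is the decrement of \<open>W\<close>
      and \<open>s k\<close> the increment of \<open>t\<close>.\<close>
    have parts: "(\<Sum>k<Suc m. s k * W k) = (\<Sum>k<Suc m. w k * t k) + t m * W (Suc m)" for m
    proof (induction m)
      case 0
      show ?case using W_Suc[of 0] by (simp add: t_def algebra_simps)
    next
      case (Suc m)
      have "t (Suc m) = t m + s (Suc m)" by (simp add: t_def)
      thus ?case using Suc W_Suc[of "Suc m"] by (simp add: algebra_simps)
    qed
    have "summable (\<lambda>k. s k * W k)"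
    proof (rule summableI_nonneg_bounded)
      show "0 \<le> s n * W n" for n
        unfolding W_def using s0[of n] w_pos summable_ignore_initial_segment[OF True, of n]
        by (intro mult_nonneg_nonneg suminf_nonneg) (auto intro: less_imp_le)
      show "(\<Sum>k<m. s k * W k) \<le> (\<Sum>n. w n * t n)" for m
      proof (cases m)
        case 0
        have "0 \<le> (\<Sum>n. w n * t n)"
          by (intro suminf_nonneg S mult_nonneg_nonneg less_imp_le[OF w_pos] t0)
        thus ?thesis using 0 by simp
      next
        case (Suc j)
        have sw: "summable (\<lambda>n. w (n + Suc j))" "summable (\<lambda>n. w (n + Suc j) * t (n + Suc j))"
          using summable_ignore_initial_segment[OF True, of "Suc j"] 
            summable_ignore_initial_segment[OF S, of "Suc j"] by auto
        \<comment> \<open>The boundary term is absorbed by the rest of the series beyond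
          \<open>j\<close>, because \<open>t\<close> is increasing.\<close>
        have "t j * W (Suc j) = (\<Sum>n. t j * w (n + Suc j))"
          unfolding W_def using sw(1) by (rule suminf_mult[symmetric])
        also have "\<dots> \<le> (\<Sum>n. w (n + Suc j) * t (n + Suc j))"
        proof (rule suminf_le)
          show "t j * w (n + Suc j) \<le> w (n + Suc j) * t (n + Suc j)" for n
            using t_mono[of j "n + Suc j"] w_pos[of "n + Suc j"]
            by (simp add: mult.commute mult_left_mono)
        qed (use sw in \<open>auto intro: summable_mult\<close>)
        finally have "t j * W (Suc j) \<le> (\<Sum>n. w (n + Suc j) * t (n + Suc j))" .
        thus ?thesis unfolding Suc parts using suminf_split_initial_segment[OF S, of "Suc j"] by simp
      qed
    qed
    thus False using \<sigma>(3) by (simp add: s_def)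
  qed
  moreover have "w n * s n = \<sigma> n" for n using w_pos[of n] by (simp add: s_def)
  ultimately show ?thesis using that[of s] s0 \<sigma>(2) unfolding t_def by simp
qed

end

section \<open>Zeros of power series\<close>

text \<open>Compactness yields one radius \<open>e\<close> that works at every point of the closed
  disc; a point between the two circles is within \<open>e\<close> of its radial projection
  \<open>u\<close>.\<close>

lemma cball_0_subset_open:
  fixes U :: "complex set"
  assumes "open U" "cball 0 \<rho> \<subseteq> U" "\<rho> \<ge> 0"
  obtains R where "R > \<rho>" "ball 0 R \<subseteq> U"
proof -
  obtain e where e: "e > 0" "(\<Union>x\<in>cball 0 \<rho>. ball x e) \<subseteq> U"
    using compact_subset_open_imp_ball_epsilon_subset[OF compact_cball assms(1,2)] by blast
  have "z \<in> U" if z: "z \<in> ball 0 (\<rho> + e)" for z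
  proof (cases "cmod z \<le> \<rho>")
    case True
    thus ?thesis using assms by auto
  next
    case False
    define u where "u = of_real (\<rho> / cmod z) * z"
    have z0: "cmod z > 0" using False assms(3) by linarith
    have u: "cmod u = \<rho>" using z0 assms(3) by (simp add: u_def norm_mult norm_divide)
    have "u - z = of_real (\<rho> / cmod z - 1) * z" by (simp add: u_def algebra_simps)
    hence "cmod (u - z) = \<bar>\<rho> / cmod z - 1\<bar> * cmod z" by (simp only: norm_mult norm_of_real)
    also have "\<dots> = \<bar>\<rho> - cmod z\<bar>" using z0 by (simp add: field_simps abs_if)
    finally have "dist u z < e" using False z by (simp add: dist_norm)
    thus ?thesis using e(2) u by force
  qed
  hence "ball 0 (\<rho> + e) \<subseteq> U" by blast
  thus ?thesis by (rule that[rotated]) (use e in simp)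
qed

lemma eval_fps_nonzero:
  fixes B :: "complex fps"
  assumes "B \<noteq> 0" "ereal R \<le> fps_conv_radius B" "R > 0"
  obtains z where "z \<in> ball 0 R" "eval_fps B z \<noteq> 0"
proof (rule ccontr)
  assume "\<not> thesis"
  hence zero: "\<And>z. z \<in> ball 0 R \<Longrightarrow> eval_fps B z = 0" using that by blast
  have "fps_conv_radius B > 0" using assms by (metis ereal_less(2) less_le_trans)
  moreover have "\<forall>\<^sub>F z in nhds 0. z \<in> ball (0::complex) R"
    using assms by (intro eventually_nhds_in_open) auto
  hence "\<forall>\<^sub>F z in nhds 0. eval_fps B z = eval_fps 0 z"
    by eventually_elim (simp add: zero)
  ultimately have "B = 0" by (intro eval_fps_eqD) auto
  thus False using assms by simp
qed

text \<open>A zero of order \<open>n\<close> is divided out on the whole disc: near \<open>z\<close>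
  the quotient is the local factor \<open>g\<close>, elsewhere it is a plain quotient of holomorphic
  functions. \<open>C\<close> is its Taylor series at 0, which converges on the disc.\<close>

lemma eval_fps_factor_zero:
  fixes B :: "complex fps"
  assumes B: "B \<noteq> 0" "ereal R \<le> fps_conv_radius B" and z: "cmod z < R" "eval_fps B z = 0"
  obtains n C where "n > 0" "B = (fps_X - fps_const z) ^ n * C" 
    "ereal R \<le> fps_conv_radius C" "eval_fps C z \<noteq> 0"
    "\<forall>u. cmod u < R \<longrightarrow> eval_fps B u = (u - z) ^ n * eval_fps C u"
proof -
  define f where "f = eval_fps B"
  have R: "R > 0" using z norm_ge_zero[of z] by linarith
  have sub: "ball 0 R \<subseteq> eball 0 (fps_conv_radius B)"
    using B(2) ball_eball_mono by blast
  have holf: "f holomorphic_on ball 0 R"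
    unfolding f_def by (rule holomorphic_on_eval_fps[OF sub])
  obtain v where v: "v \<in> ball 0 R" "f v \<noteq> 0"
    unfolding f_def using eval_fps_nonzero[OF B R] by blast
  have nc: "\<not> f constant_on ball 0 R"
    using v z unfolding constant_on_def f_def by (metis mem_ball_0)
  have z': "z \<in> ball 0 R" "f z = 0" using z by (auto simp: f_def)
  obtain g \<epsilon> n where g: "0 < n" "0 < \<epsilon>" "ball z \<epsilon> \<subseteq> ball 0 R" "g holomorphic_on ball z \<epsilon>"
      "\<And>w. w \<in> ball z \<epsilon> \<Longrightarrow> f w = (w - z) ^ n * g w" "\<And>w. w \<in> ball z \<epsilon> \<Longrightarrow> g w \<noteq> 0"
    by (rule holomorphic_factor_zero_nonconstant[OF holf open_ball connected_ball z' nc]) blast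
  define h where "h w = (if w = z then g z else f w / (w - z) ^ n)" for w
  have hg: "h w = g w" if "w \<in> ball z \<epsilon>" for w
    using g(5)[OF that] by (simp add: h_def)
  have fh: "f w = (w - z) ^ n * h w" for w
    using z(2) g(1) by (simp add: h_def f_def)
  have "h holomorphic_on ball z \<epsilon>"
    using g(4) by (rule holomorphic_transform) (rule hg[symmetric])
  moreover have "h holomorphic_on (ball 0 R - {z})"
  proof -
    have "(\<lambda>w. f w / (w - z) ^ n) holomorphic_on (ball 0 R - {z})"
      by (intro holomorphic_intros holomorphic_on_subset[OF holf]) auto
    thus ?thesis by (rule holomorphic_transform) (simp add: h_def)
  qed
  ultimately have "h holomorphic_on ball z \<epsilon> \<union> (ball 0 R - {z})"
    by (intro holomorphic_on_Un) auto
  moreover have "ball z \<epsilon> \<union> (ball 0 R - {z}) = ball 0 R" using g by auto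
  ultimately have "h holomorphic_on ball 0 R" by simp
  hence holh: "h holomorphic_on eball 0 (ereal R)" by simp
  define C where "C = fps_expansion h 0"
  have C: "ereal R \<le> fps_conv_radius C" unfolding C_def by (rule conv_radius_fps_expansion[OF holh])
  have evC: "eval_fps C u = h u" if "cmod u < R" for u
    unfolding C_def using eval_fps_expansion'[OF holh, of u] that by simp
  have inf: "fps_conv_radius ((fps_X - fps_const z) ^ n) = \<infinity>" 
    and evX: "eval_fps ((fps_X - fps_const z) ^ n) u = (u - z) ^ n" for u
  proof -
    have eq: "(fps_X - fps_const z) ^ n = fps_of_poly ([:- z, 1:] ^ n)"
      by (simp add: fps_of_poly_power fps_of_poly_pCons)
    show "fps_conv_radius ((fps_X - fps_const z) ^ n) = \<infinity>" unfolding eq by simp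
    show "eval_fps ((fps_X - fps_const z) ^ n) u = (u - z) ^ n" unfolding eq by simp
  qed
  have evprod: "eval_fps ((fps_X - fps_const z) ^ n * C) u = (u - z) ^ n * h u" if "cmod u < R" for u
  proof -
    have "ereal (cmod u) < fps_conv_radius C"
      by (rule less_le_trans[OF _ C]) (use that in simp)
    thus ?thesis using eval_fps_mult[of u "(fps_X - fps_const z) ^ n" C] evC[OF that]
      by (simp add: inf evX)
  qed
  have eqB: "B = (fps_X - fps_const z) ^ n * C"
  proof (rule eval_fps_eqD)
    have R': "0 < ereal R" using R by simp
    show "fps_conv_radius B > 0" using B(2) R' by (rule less_le_trans[rotated])
    have "fps_conv_radius C > 0" using C R' by (rule less_le_trans[rotated])
    thus "fps_conv_radius ((fps_X - fps_const z) ^ n * C) > 0"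
      by (intro less_le_trans[OF _ fps_conv_radius_mult]) (simp add: inf)
    have "\<forall>\<^sub>F u in nhds 0. u \<in> ball (0::complex) R"
      using R by (intro eventually_nhds_in_open) auto
    thus "\<forall>\<^sub>F u in nhds 0. eval_fps B u = eval_fps ((fps_X - fps_const z) ^ n * C) u"
    proof eventually_elim
      case (elim u)
      have "eval_fps B u = (u - z) ^ n * h u" using fh[of u] unfolding f_def .
      thus ?case using elim by (simp only: evprod mem_ball_0)
    qed
  qed
  have nz: "eval_fps C z \<noteq> 0" using evC[OF z(1)] g(2) g(6)[of z] by (simp add: h_def)
  have evB: "\<forall>u. cmod u < R \<longrightarrow> eval_fps B u = (u - z) ^ n * eval_fps C u"
    using fh evC unfolding f_def by metis
  show ?thesis by (rule that[OF g(1) eqB C nz evB])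
qed

section \<open>Multiplication operators on the Hahn space\<close>

text \<open>Stated on whole series, so that its commutation with products is an algebraic identity;
  the Hahn norm is the weighted l1 norm of the coefficients of this series.\<close>

definition fps_delta :: "complex fps \<Rightarrow> complex fps" where
  "fps_delta F = F - fps_shift 1 F"

lemma fps_delta_nth [simp]: "fps_nth (fps_delta F) n = fps_nth F n - fps_nth F (Suc n)"
  by (simp add: fps_delta_def)

text \<open>Differencing commutes with multiplication up to a boundary term, caused by the
  coefficient that \<open>fps_shift 1\<close> drops. Multiplying by \<open>fps_X\<close>, which can
  be cancelled, turns the shifts into subtraction of constant terms.\<close>

lemma fps_delta_mult:
  "fps_delta (C * F) = C * fps_delta F - fps_const (fps_nth F 0) * fps_shift 1 C"
proof -
  have shift: "fps_X * fps_shift 1 G = G - fps_const (fps_nth G 0)" for G :: "complex fps"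
    by (rule fps_ext) simp
  have "fps_X * fps_delta (C * F)
      = fps_X * (C * fps_delta F - fps_const (fps_nth F 0) * fps_shift 1 C)"
    using shift[of "C * F"] shift[of F] shift[of C]
    unfolding fps_delta_def by (simp add: algebra_simps flip: fps_const_mult) algebra
  thus ?thesis by simp
qed

section \<open>The Hahn space as a space of power series, and boundedness of multiplication\<close>

locale hahn_weight =
  fixes d :: "nat \<Rightarrow> real" and r :: real
  assumes d_pos: "d n > 0"
    and d_mono: "mono d"
    and d_ratio: "(\<lambda>n. d (Suc n) / d n) \<longlonglongrightarrow> r"
begin

text \<open>Sequences become formal power series, so that convolution is the product of an integral
  domain.\<close>

definition H :: "complex fps set" where
  "H = {F. fps_nth F \<in> hahn_space d}"

definition N :: "complex fps \<Rightarrow> real" where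
  "N F = hahn_norm d (fps_nth F)"

lemma N_eq: "N F = (\<Sum>n. d n * cmod (fps_nth (fps_delta F) n))"
  by (simp add: N_def hahn_norm_def)

lemma H_iff: "F \<in> H \<longleftrightarrow>
    summable (\<lambda>n. d n * cmod (fps_nth (fps_delta F) n)) \<and> fps_nth F \<longlonglongrightarrow> 0"
  by (simp add: H_def hahn_space_def)

lemma d_nonneg [simp]: "0 \<le> d n"
  using d_pos[of n] by simp

lemma r_ge_1: "r \<ge> 1"
proof (rule LIMSEQ_le_const[OF d_ratio])
  show "\<exists>M. \<forall>n\<ge>M. 1 \<le> d (Suc n) / d n"
    using d_pos d_mono by (auto simp: mono_iff_le_Suc)
qed

lemma H_N_add:
  assumes "F \<in> H" "G \<in> H"
  shows "F + G \<in> H" "N (F + G) \<le> N F + N G"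
proof -
  let ?f = "\<lambda>F n. d n * cmod (fps_nth (fps_delta F) n)"
  have le: "?f (F + G) n \<le> ?f F n + ?f G n" for n
  proof -
    have "cmod (fps_nth (fps_delta (F + G)) n) 
        \<le> cmod (fps_nth (fps_delta F) n) + cmod (fps_nth (fps_delta G) n)"
      using norm_triangle_ineq[of "fps_nth (fps_delta F) n" "fps_nth (fps_delta G) n"]
      by (simp add: algebra_simps)
    thus ?thesis by (simp add: mult_left_mono flip: distrib_left)
  qed
  have sFG: "summable (\<lambda>n. ?f F n + ?f G n)"
    using assms by (intro summable_add) (auto simp: H_iff)
  have s: "summable (?f (F + G))"
    by (rule summable_comparison_test'[OF sFG]) (use le in auto)
  show "F + G \<in> H"
    using s assms tendsto_add[of "fps_nth F" 0 sequentially "fps_nth G" 0]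
    by (simp add: H_iff fps_add_nth[abs_def])
  have "N (F + G) \<le> (\<Sum>n. ?f F n + ?f G n)"
    unfolding N_eq by (rule suminf_le[OF le s sFG])
  also have "\<dots> = N F + N G"
    unfolding N_eq by (rule suminf_add[symmetric]) (use assms in \<open>auto simp: H_iff\<close>)
  finally show "N (F + G) \<le> N F + N G" .
qed

text \<open>Eventually the ratios of \<open>d\<close> stay below \<open>q\<close>; the finitely many
  earlier ones only cost a constant factor.\<close>

lemma weight_growth:
  assumes "q > r"
  obtains M where "M > 0" "\<And>n k. d (n + k) \<le> M * q ^ k * d n"
proof -
  have q: "q > 0" using assms r_ge_1 by simp
  have "\<forall>\<^sub>F n in sequentially. d (Suc n) / d n < q"
    using d_ratio assms by (rule order_tendstoD)
  then obtain n0 where n0: "\<And>n. n \<ge> n0 \<Longrightarrow> d (Suc n) / d n < q"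
    by (auto simp: eventually_at_top_linorder)
  define K where "K = Max (insert q ((\<lambda>n. d (Suc n) / d n) ` {..<n0}))"
  have "K \<ge> q" unfolding K_def by (intro Max_ge) auto
  with q have "K > 0" by simp
  have K: "d (Suc n) \<le> K * d n" if "n < n0" for n
  proof -
    have "d (Suc n) / d n \<le> K" unfolding K_def using that by (intro Max_ge) auto
    thus ?thesis using d_pos[of n] by (simp add: field_simps)
  qed
  \<comment> \<open>Each of the first \<open>n0\<close> steps is damped by \<open>q / K\<close>, so
    that \<open>e\<close> grows by a factor of at most \<open>q\<close> at every step.\<close>
  define e where "e n = d n * (q / K) ^ min n n0" for n
  have step: "e (Suc n) \<le> q * e n" for n
  proof (cases "n < n0")
    case True
    have "e (Suc n) = d (Suc n) * (q / K) ^ Suc n" using True by (simp add: e_def min_def)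
    also have "\<dots> \<le> (K * d n) * (q / K) ^ Suc n"
      using K[OF True] q \<open>K > 0\<close> by (intro mult_right_mono) auto
    also have "\<dots> = q * e n" using True \<open>K > 0\<close> by (simp add: e_def min_def)
    finally show ?thesis .
  next
    case False
    hence "d (Suc n) \<le> q * d n" using n0[of n] d_pos[of n] by (simp add: field_simps)
    hence "d (Suc n) * (q / K) ^ n0 \<le> q * d n * (q / K) ^ n0"
      using q \<open>K > 0\<close> by (intro mult_right_mono) auto
    thus ?thesis using False by (simp add: e_def min_absorb2 mult.assoc)
  qed
  have e: "e (n + k) \<le> q ^ k * e n" for n k
  proof (induction k)
    case (Suc k)
    have "e (n + Suc k) \<le> q * e (n + k)" using step by simp
    also have "\<dots> \<le> q * (q ^ k * e n)" using Suc q by (intro mult_left_mono) auto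
    finally show ?case by (simp add: mult_ac)
  qed simp
  have "d (n + k) \<le> (K / q) ^ n0 * q ^ k * d n" for n k
  proof -
    have "d (n + k) = e (n + k) * (K / q) ^ min (n + k) n0"
      using q \<open>K > 0\<close> by (simp add: e_def field_simps flip: power_mult_distrib)
    also have "\<dots> \<le> (q ^ k * d n) * (K / q) ^ n0"
    proof (intro mult_mono)
      have "(q / K) ^ min n n0 \<le> 1" using q \<open>K \<ge> q\<close> by (intro power_le_one) auto
      hence "e n \<le> d n" unfolding e_def using d_nonneg[of n] by (simp add: mult_left_le)
      hence "q ^ k * e n \<le> q ^ k * d n" using q by (intro mult_left_mono) auto
      thus "e (n + k) \<le> q ^ k * d n" using e[of n k] by simp
      show "(K / q) ^ min (n + k) n0 \<le> (K / q) ^ n0"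
        using q \<open>K \<ge> q\<close> by (intro power_increasing) auto
    qed (use q \<open>K > 0\<close> in auto)
    finally show ?thesis by (simp add: mult_ac)
  qed
  thus ?thesis using that[of "(K / q) ^ n0"] q \<open>K > 0\<close> by auto
qed

lemma summable_beyond:
  assumes "fps_conv_radius C > ereal r"
  obtains q where "q > r" "summable (\<lambda>k. cmod (fps_nth C k) * q ^ k)"
proof -
  obtain q where q: "ereal r < ereal q" "ereal q < fps_conv_radius C"
    using ereal_dense2[OF assms] by auto
  have "summable (\<lambda>k. norm (fps_nth C k * of_real q ^ k))"
    using q r_ge_1 by (intro norm_summable_fps) auto
  moreover have "norm (fps_nth C k * of_real q ^ k) = cmod (fps_nth C k) * q ^ k" for k
    using q r_ge_1 by (simp add: norm_mult norm_power)
  ultimately show ?thesis using q that by simp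
qed

lemma N_nonneg: "F \<in> H \<Longrightarrow> 0 \<le> N F"
  unfolding N_eq H_iff by (intro suminf_nonneg) auto

text \<open>As the coefficients tend to 0, \<open>fps_nth F n\<close> is the sum of the differences
  from \<open>n\<close> on, and \<open>d n\<close> is at most each weight occurring there.\<close>

lemma N_nth:
  assumes "F \<in> H"
  shows "d n * cmod (fps_nth F n) \<le> N F"
proof (rule LIMSEQ_le_const2)
  have "(\<lambda>m. d n * cmod (fps_nth F n - fps_nth F m)) \<longlonglongrightarrow> d n * cmod (fps_nth F n - 0)"
    using assms unfolding H_iff by (intro tendsto_intros) auto
  thus "(\<lambda>m. d n * cmod (fps_nth F n - fps_nth F m)) \<longlonglongrightarrow> d n * cmod (fps_nth F n)" by simp
  have "d n * cmod (fps_nth F n - fps_nth F m) \<le> N F" if "m \<ge> n" for m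
  proof -
    have "fps_nth F n - fps_nth F m = (\<Sum>k=n..<m. fps_nth (fps_delta F) k)"
      using sum_Suc_diff'[OF that, of "\<lambda>k. - fps_nth F k"] by simp
    hence "d n * cmod (fps_nth F n - fps_nth F m) \<le> d n * (\<Sum>k=n..<m. cmod (fps_nth (fps_delta F) k))"
      by (simp only:) (intro mult_left_mono norm_sum d_nonneg)
    also have "\<dots> = (\<Sum>k=n..<m. d n * cmod (fps_nth (fps_delta F) k))" by (rule sum_distrib_left)
    also have "\<dots> \<le> (\<Sum>k=n..<m. d k * cmod (fps_nth (fps_delta F) k))"
      by (intro sum_mono mult_right_mono monoD[OF d_mono]) auto
    also have "\<dots> \<le> N F"
      unfolding N_eq using assms unfolding H_iff by (intro sum_le_suminf) auto
    finally show ?thesis .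
  qed
  thus "\<exists>M. \<forall>m\<ge>M. d n * cmod (fps_nth F n - fps_nth F m) \<le> N F" by blast
qed

text \<open>Convolution of a summable sequence with a null sequence; Tannery's theorem allows the
  termwise limit.\<close>

lemma mult_tendsto_0:
  assumes "summable (\<lambda>k. cmod (fps_nth C k))" "fps_nth F \<longlonglongrightarrow> 0"
  shows "fps_nth (C * F) \<longlonglongrightarrow> 0"
proof -
  obtain B where B: "\<And>n. cmod (fps_nth F n) \<le> B"
    using assms(2) by (metis Bseq_def convergentI convergent_imp_Bseq)
  define a where "a k n = (if k \<le> n then fps_nth C k * fps_nth F (n - k) else 0)" for k n
  have "((\<lambda>n. \<Sum>k. a k n) \<longlongrightarrow> (\<Sum>k. 0::complex)) sequentially"
  proof (rule tannerys_theorem[THEN conjunct2, THEN conjunct2])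
    show "(\<lambda>n. a k n) \<longlonglongrightarrow> 0" for k
    proof (rule LIMSEQ_offset[of _ k])
      show "(\<lambda>n. a k (n + k)) \<longlonglongrightarrow> 0"
        unfolding a_def using assms(2) by (simp add: tendsto_mult_right_zero)
    qed
    have "0 \<le> B" using B[of 0] norm_ge_zero order_trans by blast
    hence "norm (a k n) \<le> cmod (fps_nth C k) * B" for k n
      unfolding a_def using B by (auto simp: norm_mult intro!: mult_left_mono)
    thus "\<forall>\<^sub>F (k, n) in sequentially \<times>\<^sub>F sequentially. norm (a k n) \<le> cmod (fps_nth C k) * B"
      by (intro always_eventually) auto
    show "summable (\<lambda>k. cmod (fps_nth C k) * B)" using assms(1) by (rule summable_mult2)
  qed simp
  moreover have "(\<Sum>k. a k n) = fps_nth (C * F) n" for n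
  proof -
    have "(\<Sum>k. a k n) = (\<Sum>k\<in>{0..n}. a k n)" by (rule suminf_finite) (auto simp: a_def)
    thus ?thesis by (simp add: a_def fps_mult_nth)
  qed
  ultimately show ?thesis by simp
qed

text \<open>Young's inequality with weights: by \<open>weight_growth\<close>, passing from index
  \<open>n - k\<close> to \<open>n\<close> costs a factor \<open>M * q ^ k\<close>, which the
  coefficients of \<open>C\<close> can bear for some \<open>q > r\<close>. The boundary term of
  \<open>fps_delta_mult\<close> is controlled through \<open>N_nth\<close> at index 0.\<close>

lemma mult_bounded:
  assumes "fps_conv_radius C > ereal r"
  shows "\<exists>K>0. \<forall>F\<in>H. C * F \<in> H \<and> N (C * F) \<le> K * N F"
proof -
  obtain q where q: "q > r" and sC: "summable (\<lambda>k. cmod (fps_nth C k) * q ^ k)"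
    using summable_beyond[OF assms] by blast
  obtain M where M: "M > 0" "\<And>n k. d (n + k) \<le> M * q ^ k * d n"
    using weight_growth[OF q] by blast
  have q1: "q > 1" using q r_ge_1 by simp
  define g where "g k = M * (cmod (fps_nth C k) * q ^ k)" for k
  have g0: "g k \<ge> 0" for k using M q1 by (simp add: g_def)
  have sg: "summable g" unfolding g_def using sC by (rule summable_mult)
  \<comment> \<open>One \<open>suminf g\<close> comes from the Cauchy product, one from the boundary
    term; the summand 1 makes the constant positive.\<close>
  have key: "C * F \<in> H \<and> N (C * F) \<le> (2 * suminf g + 1) * N F" if F: "F \<in> H" for F
  proof -
    define y where "y = fps_delta F"
    define e where "e n = d n * cmod (fps_nth y n)" for n
    have e0: "e n \<ge> 0" for n by (simp add: e_def)
    have se: "summable e" and Ne: "suminf e = N F"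
      using F by (auto simp: e_def[abs_def] y_def H_iff N_eq)
    have prod: "(\<lambda>n. \<Sum>k\<le>n. g k * e (n - k)) sums (suminf g * suminf e)"
      using sg se g0 e0 by (intro Cauchy_product_sums) auto
    have tail: "(\<lambda>n. g (Suc n) * N F) sums ((suminf g - g 0) * N F)"
      using sg by (intro sums_mult2) (simp add: sums_Suc_iff summable_sums)
    let ?b = "\<lambda>n. (\<Sum>k\<le>n. g k * e (n - k)) + g (Suc n) * N F"
    have bound: "d n * cmod (fps_nth (fps_delta (C * F)) n) \<le> ?b n" for n
    proof -
      have "d n * cmod (fps_nth (C * y) n)
          \<le> d n * (\<Sum>k=0..n. cmod (fps_nth C k) * cmod (fps_nth y (n - k)))"
        unfolding fps_mult_nth 
        by (intro mult_left_mono order_trans[OF norm_sum] sum_mono) (auto simp: norm_mult)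
      also have "\<dots> = (\<Sum>k\<le>n. d n * (cmod (fps_nth C k) * cmod (fps_nth y (n - k))))"
        by (simp add: sum_distrib_left atLeast0AtMost)
      also have "\<dots> \<le> (\<Sum>k\<le>n. g k * e (n - k))"
      proof (rule sum_mono)
        fix k assume "k \<in> {..n}"
        hence "d n \<le> M * q ^ k * d (n - k)" using M(2)[of "n - k" k] by simp
        hence "d n * (cmod (fps_nth C k) * cmod (fps_nth y (n - k))) 
            \<le> (M * q ^ k * d (n - k)) * (cmod (fps_nth C k) * cmod (fps_nth y (n - k)))"
          by (intro mult_right_mono) auto
        thus "d n * (cmod (fps_nth C k) * cmod (fps_nth y (n - k))) \<le> g k * e (n - k)"
          by (simp add: g_def e_def mult_ac)
      qed
      finally have 1: "d n * cmod (fps_nth (C * y) n) \<le> (\<Sum>k\<le>n. g k * e (n - k))" .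
      have "d n \<le> M * q ^ Suc n * d 0"
        using M(2)[of 0 "Suc n"] monoD[OF d_mono, of n "Suc n"] by simp
      hence "d n * (cmod (fps_nth F 0) * cmod (fps_nth C (Suc n)))
          \<le> (M * q ^ Suc n * d 0) * (cmod (fps_nth F 0) * cmod (fps_nth C (Suc n)))"
        by (intro mult_right_mono) auto
      also have "\<dots> = g (Suc n) * (d 0 * cmod (fps_nth F 0))" by (simp add: g_def mult_ac)
      also have "\<dots> \<le> g (Suc n) * N F" by (intro mult_left_mono N_nth F g0)
      finally have 2: "d n * (cmod (fps_nth F 0) * cmod (fps_nth C (Suc n))) \<le> g (Suc n) * N F" .
      have "fps_nth (fps_delta (C * F)) n = fps_nth (C * y) n - fps_nth F 0 * fps_nth C (Suc n)"
        unfolding fps_delta_mult y_def by simp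
      hence "cmod (fps_nth (fps_delta (C * F)) n)
          \<le> cmod (fps_nth (C * y) n) + cmod (fps_nth F 0) * cmod (fps_nth C (Suc n))"
        by (metis norm_mult norm_triangle_ineq4)
      hence "d n * cmod (fps_nth (fps_delta (C * F)) n)
          \<le> d n * (cmod (fps_nth (C * y) n) + cmod (fps_nth F 0) * cmod (fps_nth C (Suc n)))"
        by (intro mult_left_mono) auto
      thus ?thesis using 1 2 by (simp only: distrib_left)
    qed
    have sb: "?b sums (suminf g * suminf e + (suminf g - g 0) * N F)"
      by (rule sums_add[OF prod tail])
    have s: "summable (\<lambda>n. d n * cmod (fps_nth (fps_delta (C * F)) n))"
      by (rule summable_comparison_test'[OF sums_summable[OF sb]]) (use bound in auto)
    have "summable (\<lambda>k. cmod (fps_nth C k))"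
    proof (rule summable_comparison_test'[OF sC])
      show "norm (cmod (fps_nth C k)) \<le> cmod (fps_nth C k) * q ^ k" for k
        using one_le_power[of q k] q1 by (simp add: mult_left_le mult_le_cancel_left1)
    qed
    hence "fps_nth (C * F) \<longlonglongrightarrow> 0" using F by (intro mult_tendsto_0) (auto simp: H_iff)
    moreover have "N (C * F) \<le> (2 * suminf g + 1) * N F"
    proof -
      have "N (C * F) \<le> suminf ?b"
        unfolding N_eq[of "C * F"] by (rule suminf_le[OF bound s sums_summable[OF sb]])
      also have "\<dots> = suminf g * N F + (suminf g - g 0) * N F" using sums_unique[OF sb] Ne by simp
      also have "\<dots> \<le> (2 * suminf g + 1) * N F"
        using g0[of 0] N_nonneg[OF F] by (simp add: algebra_simps mult_nonneg_nonneg)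
      finally show ?thesis .
    qed
    ultimately show ?thesis using s by (auto simp: H_iff)
  qed
  have "suminf g \<ge> 0" using sg g0 by (rule suminf_nonneg)
  with key show ?thesis by (intro exI[of _ "2 * suminf g + 1"]) auto
qed

lemma H_N_uminus:
  assumes "F \<in> H"
  shows "- F \<in> H" "N (- F) = N F"
proof -
  have eq: "cmod (fps_nth (fps_delta (- F)) n) = cmod (fps_nth (fps_delta F) n)" for n
    by (simp add: norm_minus_commute)
  show "N (- F) = N F" unfolding N_eq eq ..
  show "- F \<in> H" using assms tendsto_minus[of "fps_nth F" 0] unfolding H_iff eq by (simp add: fps_neg_nth[abs_def])
qed

lemma H_N_diff:
  assumes "F \<in> H" "G \<in> H"
  shows "F - G \<in> H" "N (F - G) \<le> N F + N G"
  using H_N_add[of F "- G"] H_N_uminus[of G] assms by auto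

lemma N_triangle:
  assumes "F \<in> H" "G \<in> H" "K \<in> H"
  shows "N (F - K) \<le> N (F - G) + N (G - K)"
  using H_N_add(2)[of "F - G" "G - K"] H_N_diff(1) assms by simp

section \<open>Power series of larger radius as elements of the space\<close>

lemma one_in_H: "1 \<in> H"
proof -
  have "summable (\<lambda>n. d n * cmod (fps_nth (fps_delta 1) n))"
    by (rule summable_finite[of "{0}"]) auto
  moreover have "fps_nth (1 :: complex fps) \<longlonglongrightarrow> 0"
    by (rule LIMSEQ_offset[of _ 1]) simp
  ultimately show ?thesis by (simp add: H_iff)
qed

lemma mult_in_H: "fps_conv_radius C > ereal r \<Longrightarrow> F \<in> H \<Longrightarrow> C * F \<in> H"
  using mult_bounded[of C] by blast

lemma in_H: "fps_conv_radius C > ereal r \<Longrightarrow> C \<in> H"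
  using mult_in_H[of C 1] one_in_H by simp

lemma radius_mult:
  "fps_conv_radius C > ereal r \<Longrightarrow> fps_conv_radius D > ereal r \<Longrightarrow> fps_conv_radius (C * D) > ereal r"
  by (rule less_le_trans[OF _ fps_conv_radius_mult]) auto

lemma radius_finite_support:
  assumes "\<And>n. n > m \<Longrightarrow> fps_nth P n = 0"
  shows "fps_conv_radius P > ereal r"
proof -
  have "summable (\<lambda>n. fps_nth P n * of_real (r + 1) ^ n)"
    by (rule summable_finite[of "{..m}"]) (use assms in auto)
  from conv_radius_geI[OF this] have "ereal (r + 1) \<le> fps_conv_radius P"
    unfolding fps_conv_radius_def norm_of_real using r_ge_1 by simp
  moreover have "ereal r < ereal (r + 1)" by simp
  ultimately show ?thesis by (rule less_le_trans[rotated])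
qed

lemma finite_support_dense:
  assumes F: "F \<in> H" and "e > 0"
  obtains P where "fps_conv_radius P > ereal r" "N (F - P) < e"
proof -
  let ?f = "\<lambda>n. d n * cmod (fps_nth (fps_delta F) n)"
  have sf: "summable ?f" using F by (simp add: H_iff)
  from suminf_exist_split[OF \<open>e > 0\<close> sf] obtain m
    where m: "norm (\<Sum>i. ?f (i + m)) < e" by blast
  \<comment> \<open>Subtracting \<open>fps_nth F m\<close> from the initial coefficients avoids a
    jump at \<open>m\<close>: the differences of \<open>P\<close> are those of \<open>F\<close>
    below \<open>m\<close> and 0 from \<open>m\<close> on.\<close>
  define P where "P = Abs_fps (\<lambda>n. if n < m then fps_nth F n - fps_nth F m else 0)"
  have delta: "fps_nth (fps_delta (F - P)) n = (if n < m then 0 else fps_nth (fps_delta F) n)" for n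
    by (cases "Suc n = m") (auto simp: P_def)
  have "N (F - P) = (\<Sum>i. if i < m then 0 else ?f i)"
    unfolding N_eq delta by (intro suminf_cong) auto
  also have "\<dots> = (\<Sum>i. ?f (i + m))"
  proof (rule sums_unique[symmetric])
    have "(\<lambda>i. if i + m < m then 0 else ?f (i + m)) sums (\<Sum>i. ?f (i + m))"
      using summable_sums[OF summable_ignore_initial_segment[OF sf, of m]] by simp
    thus "(\<lambda>i. if i < m then 0 else ?f i) sums (\<Sum>i. ?f (i + m))"
      using sums_iff_shift'[of "\<lambda>i. if i < m then 0 else ?f i" m "\<Sum>i. ?f (i + m)"] by simp
  qed
  also have "\<dots> < e" using m by simp
  finally have "N (F - P) < e" .
  moreover have "fps_conv_radius P > ereal r"
    by (rule radius_finite_support[of m]) (simp add: P_def)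
  ultimately show ?thesis using that by blast
qed

section \<open>Multipliers with dense range\<close>

definition dense_range :: "complex fps \<Rightarrow> bool" where
  "dense_range B \<longleftrightarrow> (\<forall>F\<in>H. \<forall>e>0. \<exists>G\<in>H. N (F - B * G) < e)"

text \<open>Approximate \<open>F\<close> by \<open>A * G\<close> and then \<open>G\<close> by
  \<open>B * L\<close>; boundedness of multiplication by \<open>A\<close> carries the second error
  over.\<close>

lemma dense_range_mult:
  assumes A: "dense_range A" "fps_conv_radius A > ereal r"
    and B: "dense_range B" "fps_conv_radius B > ereal r"
  shows "dense_range (A * B)"
  unfolding dense_range_def
proof (intro ballI allI impI)
  fix F e assume F: "F \<in> H" and e: "(e::real) > 0"
  obtain K where K: "K > 0" "\<And>F. F \<in> H \<Longrightarrow> N (A * F) \<le> K * N F"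
    using mult_bounded[OF A(2)] by blast
  obtain G where G: "G \<in> H" "N (F - A * G) < e / 2"
    using A(1) F e unfolding dense_range_def by (meson half_gt_zero)
  have "e / (2 * K) > 0" using e K by simp
  then obtain L where L: "L \<in> H" "N (G - B * L) < e / (2 * K)"
    using B(1) G(1) unfolding dense_range_def by meson
  have BL: "B * L \<in> H" using B L by (intro mult_in_H)
  have "N (F - A * B * L) \<le> N (F - A * G) + N (A * G - A * (B * L))"
    using N_triangle[of F "A * G" "A * (B * L)"] F G BL A(2) by (simp add: mult_in_H mult.assoc)
  also have "A * G - A * (B * L) = A * (G - B * L)" by (simp add: algebra_simps)
  also have "N \<dots> \<le> K * N (G - B * L)" using K G BL H_N_diff by blast
  also have "K * N (G - B * L) < e / 2" using L K by (simp add: field_simps)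
  finally have "N (F - A * B * L) < e" using G by simp
  thus "\<exists>G\<in>H. N (F - A * B * G) < e" using L by blast
qed

lemma dense_range_power:
  assumes "dense_range A" "fps_conv_radius A > ereal r"
  shows "dense_range (A ^ n)"
proof (induction n)
  case 0
  have "N (F - 1 * F) = 0" for F by (simp add: N_eq)
  thus ?case unfolding dense_range_def power_0 by metis
next
  case (Suc n)
  have "fps_conv_radius (A ^ n) > ereal r"
    by (rule less_le_trans[OF assms(2) fps_conv_radius_power])
  with Suc assms show ?case by (simp add: dense_range_mult)
qed

text \<open>The closure of the range is an ideal, and finitely supported sequences are dense.\<close>

lemma dense_rangeI:
  assumes B: "fps_conv_radius B > ereal r"
    and one: "\<And>e. e > 0 \<Longrightarrow> \<exists>G\<in>H. N (1 - B * G) < e"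
  shows "dense_range B"
  unfolding dense_range_def
proof (intro ballI allI impI)
  fix F e assume F: "F \<in> H" and e: "(e::real) > 0"
  obtain P where P: "fps_conv_radius P > ereal r" "N (F - P) < e / 2"
    using finite_support_dense[OF F half_gt_zero[OF e]] by blast
  obtain K where K: "K > 0" "\<And>F. F \<in> H \<Longrightarrow> N (P * F) \<le> K * N F"
    using mult_bounded[OF P(1)] by blast
  have "e / (2 * K) > 0" using e K by simp
  then obtain G where G: "G \<in> H" "N (1 - B * G) < e / (2 * K)" using one by meson
  have *: "1 - B * G \<in> H" "P \<in> H" "B * (P * G) \<in> H" "P * G \<in> H"
    using H_N_diff(1)[OF one_in_H mult_in_H[OF B G(1)]] in_H[OF P(1)] mult_in_H[OF P(1) G(1)]
      mult_in_H[OF B mult_in_H[OF P(1) G(1)]] by auto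
  have "N (F - B * (P * G)) \<le> N (F - P) + N (P - B * (P * G))"
    using N_triangle[OF F *(2,3)] .
  also have "P - B * (P * G) = P * (1 - B * G)" by (simp add: algebra_simps)
  also have "N \<dots> \<le> K * N (1 - B * G)" using K * by blast
  also have "K * N (1 - B * G) < e / 2" using G K by (simp add: field_simps)
  finally have "N (F - B * (P * G)) < e" using P by simp
  thus "\<exists>G\<in>H. N (F - B * G) < e" using * by blast
qed

text \<open>Summation by parts: the points at which evaluation of the generating function extends to a
  continuous functional on the space.\<close>

definition regular_point :: "complex \<Rightarrow> bool" where
  "regular_point z \<longleftrightarrow> (\<exists>K. \<forall>n. cmod (\<Sum>k\<le>n. z ^ k) \<le> K * d n)"

definition ev :: "complex \<Rightarrow> complex fps \<Rightarrow> complex" where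
  "ev z F = (\<Sum>n. fps_nth (fps_delta F) n * (\<Sum>k\<le>n. z ^ k))"

context
  fixes z K
  assumes K: "\<And>n. cmod (\<Sum>k\<le>n. z ^ k) \<le> K * d n"
begin

lemma K_pos: "K > 0"
proof -
  have "1 \<le> K * d 0" using K[of 0] by simp
  hence "0 < K * d 0" by linarith
  thus ?thesis using d_pos[of 0] by (simp add: zero_less_mult_iff)
qed

lemma ev_summable:
  assumes "F \<in> H"
  shows "summable (\<lambda>n. cmod (fps_nth (fps_delta F) n * (\<Sum>k\<le>n. z ^ k)))"
    and "(\<Sum>n. cmod (fps_nth (fps_delta F) n * (\<Sum>k\<le>n. z ^ k))) \<le> K * N F"
proof -
  have b: "cmod (fps_nth (fps_delta F) n * (\<Sum>k\<le>n. z ^ k)) 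
      \<le> K * (d n * cmod (fps_nth (fps_delta F) n))" for n
    using mult_left_mono[OF K[of n], of "cmod (fps_nth (fps_delta F) n)"]
    by (simp add: norm_mult mult_ac)
  have s: "summable (\<lambda>n. K * (d n * cmod (fps_nth (fps_delta F) n)))"
    using assms by (intro summable_mult) (simp add: H_iff)
  show 1: "summable (\<lambda>n. cmod (fps_nth (fps_delta F) n * (\<Sum>k\<le>n. z ^ k)))"
    by (rule summable_comparison_test'[OF s]) (use b in simp)
  have "(\<Sum>n. cmod (fps_nth (fps_delta F) n * (\<Sum>k\<le>n. z ^ k)))
      \<le> (\<Sum>n. K * (d n * cmod (fps_nth (fps_delta F) n)))"
    by (rule suminf_le[OF b 1 s])
  also have "\<dots> = K * N F"
    unfolding N_eq using assms by (intro suminf_mult) (simp add: H_iff)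
  finally show "(\<Sum>n. cmod (fps_nth (fps_delta F) n * (\<Sum>k\<le>n. z ^ k))) \<le> K * N F" .
qed

lemma ev_bounded: "F \<in> H \<Longrightarrow> cmod (ev z F) \<le> K * N F"
  unfolding ev_def by (rule order_trans[OF summable_norm[OF ev_summable(1)] ev_summable(2)])

lemma ev_diff:
  assumes "F \<in> H" "G \<in> H"
  shows "ev z (F - G) = ev z F - ev z G"
proof -
  have "ev z F - ev z G = (\<Sum>n. fps_nth (fps_delta F) n * (\<Sum>k\<le>n. z ^ k)
      - fps_nth (fps_delta G) n * (\<Sum>k\<le>n. z ^ k))"
    unfolding ev_def using assms
    by (intro suminf_diff summable_norm_cancel[OF ev_summable(1)]) auto
  also have "\<dots> = ev z (F - G)"
    unfolding ev_def by (intro suminf_cong) (simp add: algebra_simps)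
  finally show ?thesis ..
qed

text \<open>Abel summation: the partial sums of the two series differ by the boundary term in
  \<open>part\<close>. It tends to 0, since the coefficients of \<open>D\<close> are o(q^-m) while
  the geometric sums are O(\<open>d m\<close>), hence O(q^m).\<close>

lemma ev_eq_eval_fps:
  assumes D: "fps_conv_radius D > ereal r" and z: "cmod z \<le> r"
  shows "ev z D = eval_fps D z"
proof -
  obtain q where q: "q > r" and sD: "summable (\<lambda>k. cmod (fps_nth D k) * q ^ k)"
    using summable_beyond[OF D] by blast
  obtain M where M: "M > 0" "\<And>n k. d (n + k) \<le> M * q ^ k * d n"
    using weight_growth[OF q] by blast
  have K0: "K \<ge> 0" using K_pos by simp
  have part: "(\<Sum>n<m. fps_nth (fps_delta D) n * (\<Sum>k\<le>n. z ^ k))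
      = (\<Sum>n<m. fps_nth D n * z ^ n) - fps_nth D m * (\<Sum>k<m. z ^ k)" for m
    by (induction m) (simp_all add: algebra_simps lessThan_Suc_atMost[symmetric])
  have lim0: "(\<lambda>m. fps_nth D m * (\<Sum>k<m. z ^ k)) \<longlonglongrightarrow> 0"
  proof (rule Lim_null_comparison)
    show "(\<lambda>m. (K * M * d 0) * (cmod (fps_nth D m) * q ^ m)) \<longlonglongrightarrow> 0"
      using tendsto_mult_right_zero[OF summable_LIMSEQ_zero[OF sD]] .
    show "\<forall>\<^sub>F m in sequentially. norm (fps_nth D m * (\<Sum>k<m. z ^ k)) 
        \<le> (K * M * d 0) * (cmod (fps_nth D m) * q ^ m)"
    proof (rule eventually_sequentiallyI[of 1])
      fix m :: nat assume "m \<ge> 1"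
      then obtain m' where m: "m = Suc m'" by (cases m) auto
      have "cmod (\<Sum>k<m. z ^ k) \<le> K * d m'" unfolding m lessThan_Suc_atMost by (rule K)
      also have "\<dots> \<le> K * d m" using K0 m monoD[OF d_mono, of m' m] by (intro mult_left_mono) auto
      also have "\<dots> \<le> K * (M * q ^ m * d 0)" using M(2)[of 0 m] K0 by (intro mult_left_mono) auto
      finally have "cmod (fps_nth D m) * cmod (\<Sum>k<m. z ^ k) 
          \<le> cmod (fps_nth D m) * (K * (M * q ^ m * d 0))"
        by (rule mult_left_mono) simp
      thus "norm (fps_nth D m * (\<Sum>k<m. z ^ k)) \<le> (K * M * d 0) * (cmod (fps_nth D m) * q ^ m)"
        by (simp add: norm_mult mult_ac)
    qed
  qed
  have "ereal (cmod z) < fps_conv_radius D" using z D by (meson ereal_less_eq(3) le_less_trans)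
  hence "(\<lambda>m. \<Sum>n<m. fps_nth D n * z ^ n) \<longlonglongrightarrow> eval_fps D z"
    using sums_eval_fps[of z D] by (simp add: sums_def)
  from tendsto_diff[OF this lim0] 
  have "(\<lambda>n. fps_nth (fps_delta D) n * (\<Sum>k\<le>n. z ^ k)) sums eval_fps D z"
    unfolding sums_def part by simp
  thus ?thesis unfolding ev_def by (rule sums_unique[symmetric])
qed

text \<open>On power series of larger radius, evaluation is multiplicative, so it kills
  \<open>B * P\<close>. Such \<open>P\<close> are dense, and both multiplication by \<open>B\<close>
  and \<open>ev z\<close> are continuous.\<close>

lemma ev_mult_eq_0:
  assumes B: "fps_conv_radius B > ereal r" and z: "cmod z \<le> r" "eval_fps B z = 0" and G: "G \<in> H"
  shows "ev z (B * G) = 0"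
proof (rule ccontr)
  assume nz: "ev z (B * G) \<noteq> 0"
  obtain L where L: "L > 0" "\<And>F. F \<in> H \<Longrightarrow> N (B * F) \<le> L * N F"
    using mult_bounded[OF B] by blast
  have K0: "K > 0" by (rule K_pos)
  \<comment> \<open>Chosen such that \<open>K * L * e\<close> is exactly the modulus to be
    contradicted.\<close>
  define e where "e = cmod (ev z (B * G)) / (K * L)"
  have "e > 0" using nz K0 L by (simp add: e_def)
  then obtain P where P: "fps_conv_radius P > ereal r" "N (G - P) < e"
    using finite_support_dense[OF G] by blast
  have PH: "P \<in> H" using P by (simp add: in_H)
  have zr: "ereal (cmod z) < fps_conv_radius B" "ereal (cmod z) < fps_conv_radius P"
    using z(1) B P(1) by (meson ereal_less_eq(3) le_less_trans)+
  have "ev z (B * P) = 0"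
    using ev_eq_eval_fps[OF radius_mult[OF B P(1)] z(1)] eval_fps_mult[OF zr] z(2) by simp
  hence "ev z (B * G) = ev z (B * (G - P))"
    using ev_diff[of "B * G" "B * P"] G PH B by (simp add: mult_in_H algebra_simps)
  also have "cmod \<dots> \<le> K * N (B * (G - P))"
    using G PH B by (intro ev_bounded mult_in_H H_N_diff) auto
  also have "\<dots> \<le> K * (L * N (G - P))" using L G PH K0 H_N_diff by (intro mult_left_mono) auto
  also have "\<dots> < K * (L * e)" using P K0 L by simp
  also have "\<dots> = cmod (ev z (B * G))" using K0 L by (simp add: e_def)
  finally show False by simp
qed

text \<open>The continuous functional \<open>ev z\<close> vanishes on the range, but is 1 at the
  series 1, which therefore keeps a distance of at least \<open>1 / K\<close> from the
  range.\<close>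

lemma not_dense_range_aux:
  assumes B: "fps_conv_radius B > ereal r" and z: "cmod z \<le> r" "eval_fps B z = 0"
  shows "\<not> dense_range B"
proof
  assume "dense_range B"
  have K0: "K \<ge> 0" using K_pos by simp
  have "1 / (K + 1) > 0" using K0 by simp
  with \<open>dense_range B\<close> obtain G where G: "G \<in> H" "N (1 - B * G) < 1 / (K + 1)"
    unfolding dense_range_def using one_in_H by meson
  have BG: "B * G \<in> H" using B G by (intro mult_in_H)
  have "ev z 1 = 1" using ev_eq_eval_fps[of 1] z by simp
  hence "ev z (1 - B * G) = 1"
    using ev_diff[OF one_in_H BG] ev_mult_eq_0[OF B z G(1)] by simp
  hence "1 \<le> K * N (1 - B * G)" using ev_bounded[OF H_N_diff(1)[OF one_in_H BG]] by simp
  also have "\<dots> \<le> K * (1 / (K + 1))" using G K0 by (intro mult_left_mono) auto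
  also have "\<dots> < 1" using K0 by simp
  finally show False by simp
qed

end

lemma not_dense_range:
  assumes "regular_point z" "fps_conv_radius B > ereal r" "cmod z \<le> r" "eval_fps B z = 0"
  shows "\<not> dense_range B"
  proof -
  from assms(1) obtain K where "\<And>n. cmod (\<Sum>k\<le>n. z ^ k) \<le> K * d n"
    unfolding regular_point_def by blast
  thus ?thesis by (rule not_dense_range_aux) (use assms in auto)
qed

section \<open>The factors X - z at irregular points\<close>

lemma linear_radius: "fps_conv_radius (fps_X - fps_const z) > ereal r"
  by (rule radius_finite_support[of 1]) (auto simp: fps_X_def)

lemma dense_range_linear:
  assumes z: "\<not> regular_point z"
  shows "dense_range (fps_X - fps_const z)"
proof (rule dense_rangeI[OF linear_radius])
  fix e :: real assume e: "e > 0"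
  obtain n where n: "cmod (\<Sum>k\<le>n. z ^ k) > (1 / e) * d n"
    using z unfolding regular_point_def by (meson not_le)
  define g where "g = (\<Sum>k\<le>n. z ^ k)"
  have "(1 / e) * d n \<ge> 0" using e by simp
  hence g: "cmod g > 0" using n unfolding g_def by linarith
  define p :: "complex poly" where "p = (\<Sum>k\<le>n. monom 1 k)"
  have coeff: "coeff p k = (if k \<le> n then 1 else 0)" for k
    by (simp add: p_def coeff_sum)
  \<comment> \<open>\<open>smult (1 / g) p\<close> has the value 1 at \<open>z\<close>, so its
    difference from 1 is divisible by the linear polynomial.\<close>
  have "poly (1 - smult (1 / g) p) z = 0"
    using g by (simp add: p_def poly_sum poly_monom g_def)
  then obtain s where s: "1 - smult (1 / g) p = [:- z, 1:] * s"
    by (metis dvdE poly_eq_0_iff_dvd)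
  have "fps_of_poly (1 - smult (1 / g) p) = (fps_X - fps_const z) * fps_of_poly s"
    unfolding s fps_of_poly_mult by (simp add: fps_of_poly_pCons)
  hence eq: "1 - (fps_X - fps_const z) * fps_of_poly s = fps_of_poly (smult (1 / g) p)"
    by (simp add: fps_of_poly_diff algebra_simps)
  \<comment> \<open>The coefficients are constant up to \<open>n\<close> and 0 afterwards, so there
    is a single nonzero difference, at \<open>n\<close>.\<close>
  have "N (fps_of_poly (smult (1 / g) p)) = (\<Sum>k\<in>{n}. d k * cmod (1 / g))"
    unfolding N_eq by (subst suminf_finite[of "{n}"]) (auto simp: coeff)
  also have "\<dots> < e" using n e g by (simp add: norm_divide field_simps flip: g_def)
  finally have "N (1 - (fps_X - fps_const z) * fps_of_poly s) < e" by (simp add: eq)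
  thus "\<exists>G\<in>H. N (1 - (fps_X - fps_const z) * G) < e"
    using in_H[of "fps_of_poly s"] by auto
qed

section \<open>Surjectivity and its failure\<close>

definition onto :: "complex fps \<Rightarrow> bool" where
  "onto B \<longleftrightarrow> (\<forall>F\<in>H. \<exists>G\<in>H. B * G = F)"

lemma onto_imp_dense_range: "onto B \<Longrightarrow> dense_range B"
proof -
  have "N (F - F) = 0" for F by (simp add: N_eq)
  thus "onto B \<Longrightarrow> dense_range B" unfolding onto_def dense_range_def by metis
qed

lemma onto_mult_left:
  assumes "onto (A * C)" "fps_conv_radius C > ereal r"
  shows "onto A"
  unfolding onto_def
proof
  fix F assume "F \<in> H"
  then obtain G where "G \<in> H" "A * C * G = F" using assms(1) unfolding onto_def by blast
  thus "\<exists>G\<in>H. A * G = F" using assms(2) mult_in_H by (intro bexI[of _ "C * G"]) (auto simp: mult.assoc)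
qed

text \<open>Weighted summability of the coefficients themselves bounds their differences, as
  \<open>d n \<le> d (Suc n)\<close>.\<close>

lemma in_H_weighted:
  assumes "summable (\<lambda>n. d n * cmod (fps_nth F n))"
  shows "F \<in> H"
proof -
  let ?f = "\<lambda>n. d n * cmod (fps_nth F n)"
  have s: "summable (\<lambda>n. ?f n + ?f (Suc n))"
    using assms by (intro summable_add) (auto simp: summable_Suc_iff[of ?f])
  have le: "d n * cmod (fps_nth (fps_delta F) n) \<le> ?f n + ?f (Suc n)" for n
  proof -
    have "d n * cmod (fps_nth (fps_delta F) n) \<le> d n * (cmod (fps_nth F n) + cmod (fps_nth F (Suc n)))"
      by (intro mult_left_mono) (auto intro: norm_triangle_ineq4)
    also have "\<dots> \<le> ?f n + ?f (Suc n)"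
      using mult_right_mono[OF monoD[OF d_mono, of n "Suc n"], of "cmod (fps_nth F (Suc n))"]
      by (simp add: distrib_left)
    finally show ?thesis .
  qed
  have "summable (\<lambda>n. d n * cmod (fps_nth (fps_delta F) n))"
    by (rule summable_comparison_test'[OF s]) (use le in auto)
  moreover have "fps_nth F \<longlonglongrightarrow> 0"
  proof (rule Lim_null_comparison)
    show "(\<lambda>n. ?f n / d 0) \<longlonglongrightarrow> 0"
      using tendsto_divide_zero[OF summable_LIMSEQ_zero[OF assms]] .
    have "cmod (fps_nth F n) \<le> ?f n / d 0" for n
      using mult_right_mono[OF monoD[OF d_mono, of 0 n], of "cmod (fps_nth F n)"] d_pos[of 0]
      by (simp add: field_simps)
    thus "\<forall>\<^sub>F n in sequentially. norm (fps_nth F n) \<le> ?f n / d 0" by simp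
  qed
  ultimately show ?thesis by (simp add: H_iff)
qed

lemma linear_nth_Suc:
  fixes z :: complex
  shows "fps_nth ((fps_X - fps_const z) * G) (Suc n) = fps_nth G n - z * fps_nth G (Suc n)"
  by (simp add: left_diff_distrib)

text \<open>The differences of \<open>G\<close> are the coefficients of
  \<open>(fps_X - fps_const 1) * G\<close> shifted by one. With the tail sums of \<open>y\<close> as
  coefficients of \<open>F\<close>, membership of \<open>F\<close> asks only for a finite weighted
  norm of \<open>y\<close>, while membership of \<open>G\<close> asks for that of its tail sums,
  against \<open>tail_Hardy_fails\<close>.\<close>

lemma not_onto_at_1:
  assumes "r = 1"
  shows "\<not> onto (fps_X - fps_const 1)"
proof
  assume onto: "onto (fps_X - fps_const 1)"
  obtain y :: "nat \<Rightarrow> real" where y: "\<And>n. 0 \<le> y n" "summable (\<lambda>n. d n * y n)"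
    "\<not> summable (\<lambda>k. y k * (\<Sum>n<k. d n))"
    using tail_Hardy_fails[OF d_pos d_ratio[unfolded assms]] by blast
  have sy: "summable y"
  proof (rule summable_comparison_test')
    show "summable (\<lambda>n. (d n * y n) / d 0)" using y(2) by (rule summable_divide)
    show "norm (y n) \<le> (d n * y n) / d 0" for n
      using mult_right_mono[OF monoD[OF d_mono, of 0 n] y(1)[of n]] d_pos[of 0] y(1)[of n]
      by (simp add: field_simps)
  qed
  \<comment> \<open>The tail of \<open>y\<close> from \<open>n\<close> on, so that \<open>y\<close>
    is the difference sequence of \<open>x\<close>.\<close>
  define x where "x n = suminf y - (\<Sum>k<n. y k)" for n
  define F where "F = Abs_fps (\<lambda>n. complex_of_real (x n))"
  have "fps_nth (fps_delta F) n = of_real (y n)" for n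
    by (simp add: F_def x_def)
  hence "cmod (fps_nth (fps_delta F) n) = y n" for n
    using y(1)[of n] by (simp del: fps_delta_nth)
  moreover have "(\<lambda>n. complex_of_real (x n)) \<longlonglongrightarrow> of_real (suminf y - suminf y)"
    unfolding x_def by (intro tendsto_intros summable_LIMSEQ sy)
  ultimately have "F \<in> H" using y(2) unfolding H_iff F_def by (simp del: fps_delta_nth add: fps_nth_Abs_fps[abs_def])
  then obtain G where G: "G \<in> H" "(fps_X - fps_const 1) * G = F"
    using onto unfolding onto_def by blast
  have x_ge: "(\<Sum>k=Suc n..m. y k) \<le> x (Suc n)" for n m
  proof -
    have "(\<Sum>k<Suc n. y k) + (\<Sum>k=Suc n..m. y k) = (\<Sum>k\<in>{..<Suc n} \<union> {Suc n..m}. y k)"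
      by (subst sum.union_disjoint) auto
    also have "\<dots> \<le> suminf y" using sy y(1) by (intro sum_le_suminf) auto
    finally show ?thesis by (simp add: x_def)
  qed
  have x0: "0 \<le> x (Suc n)" for n using x_ge[of n 0] by simp
  have "fps_nth (fps_delta G) n = of_real (x (Suc n))" for n
    using linear_nth_Suc[of 1 G n] unfolding G(2) by (simp add: F_def)
  hence "cmod (fps_nth (fps_delta G) n) = x (Suc n)" for n
    using x0[of n] by (simp del: fps_delta_nth)
  hence S: "summable (\<lambda>n. d n * x (Suc n))" using G(1) by (simp add: H_iff del: fps_delta_nth)
  have "summable (\<lambda>k. y k * (\<Sum>n<k. d n))"
  proof (rule summableI_nonneg_bounded)
    show "0 \<le> y n * (\<Sum>n<n. d n)" for n using y by (simp add: sum_nonneg)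
    fix m
    have "(\<Sum>k<m. y k * (\<Sum>n<k. d n)) \<le> (\<Sum>k\<le>m. y k * (\<Sum>n<k. d n))"
      using y by (intro sum_mono2) (auto intro!: mult_nonneg_nonneg sum_nonneg)
    also have "\<dots> = (\<Sum>k\<le>m. \<Sum>n<k. y k * d n)" by (simp add: sum_distrib_left)
    also have "\<dots> = (\<Sum>n<m. \<Sum>k=Suc n..m. y k * d n)" by (rule sum.nested_swap')
    also have "\<dots> = (\<Sum>n<m. d n * (\<Sum>k=Suc n..m. y k))" by (simp add: sum_distrib_left mult.commute)
    also have "\<dots> \<le> (\<Sum>n<m. d n * x (Suc n))" by (intro sum_mono mult_left_mono x_ge) auto
    also have "\<dots> \<le> (\<Sum>n. d n * x (Suc n))" using S x0 by (intro sum_le_suminf) auto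
    finally show "(\<Sum>k<m. y k * (\<Sum>n<k. d n)) \<le> (\<Sum>n. d n * x (Suc n))" .
  qed
  thus False using y(3) by simp
qed

text \<open>Writing coefficients as multiples of z^-n turns the recursion for \<open>G\<close> into
  summation: \<open>G\<close> is given by the partial sums \<open>t\<close> of \<open>s\<close>, up
  to the factor -1/z. The weight becomes \<open>d n / r ^ n\<close>, which varies slowly, so
  \<open>head_Hardy_fails\<close> applies.\<close>

lemma not_onto_on_circle:
  assumes r: "r > 1" and z: "cmod z = r"
  shows "\<not> onto (fps_X - fps_const z)"
proof
  assume onto: "onto (fps_X - fps_const z)"
  define w where "w n = d n / r ^ n" for n
  have r0: "r > 0" and z0: "z \<noteq> 0" using r z by auto
  have w_pos: "w n > 0" for n using d_pos r0 by (simp add: w_def)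
  have "(\<lambda>n. (d (Suc n) / d n) / r) \<longlonglongrightarrow> r / r"
    using r0 by (intro tendsto_divide d_ratio tendsto_const) auto
  moreover have "(d (Suc n) / d n) / r = w (Suc n) / w n" for n
    using r0 by (simp add: w_def field_simps)
  ultimately have w_ratio: "(\<lambda>n. w (Suc n) / w n) \<longlonglongrightarrow> 1" using r0 by simp
  obtain s :: "nat \<Rightarrow> real" where s: "\<And>n. 0 \<le> s n" "summable (\<lambda>n. w n * s n)"
    "\<not> summable (\<lambda>n. w n * (\<Sum>k\<le>n. s k))"
    using head_Hardy_fails[OF w_pos w_ratio] by blast
  define t where "t n = (\<Sum>k\<le>n. s k)" for n
  have t0: "0 \<le> t n" for n unfolding t_def using s by (simp add: sum_nonneg)
  have t_Suc: "t (Suc n) = t n + s (Suc n)" for n by (simp add: t_def)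
  define F where "F = Abs_fps (\<lambda>n. complex_of_real (s n) / z ^ n)"
  have "d n * cmod (fps_nth F n) = w n * s n" for n
    using s by (simp add: F_def w_def norm_divide norm_power z)
  hence "F \<in> H" using s(2) by (intro in_H_weighted) simp
  then obtain G where G: "G \<in> H" "(fps_X - fps_const z) * G = F"
    using onto unfolding onto_def by blast
  have Gn: "fps_nth G n = - of_real (t n) / z ^ Suc n" for n
  proof (induction n)
    case 0
    have "fps_nth ((fps_X - fps_const z) * G) 0 = - z * fps_nth G 0"
      by (simp add: left_diff_distrib)
    thus ?case using z0 unfolding G(2) by (simp add: F_def t_def field_simps)
  next
    case (Suc n)
    have "z * fps_nth G (Suc n) = fps_nth G n - fps_nth F (Suc n)"
      using linear_nth_Suc[of z G n] unfolding G(2) by (simp add: algebra_simps)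
    also have "\<dots> = - of_real (t (Suc n)) / z ^ Suc n"
      unfolding Suc F_def t_Suc by (simp add: diff_divide_distrib add_divide_distrib)
    finally show ?case using z0 by (simp add: field_simps)
  qed
  have delta: "fps_nth (fps_delta G) n = - (of_real (t n) - of_real (t (Suc n)) / z) / z ^ Suc n" for n
    using z0 by (simp add: Gn field_simps)
  \<comment> \<open>As r > 1, the differences of \<open>G\<close> still dominate \<open>t\<close>:
    the lower bound \<open>t n - t (Suc n) / r\<close> equals \<open>t n * (1 - 1 / r)\<close> up to
    a multiple of \<open>s (Suc n)\<close>, whose weighted sum converges.\<close>
  have le: "w n * t n * (1 - 1 / r) \<le> r * (d n * cmod (fps_nth (fps_delta G) n)) + w (Suc n) * s (Suc n)" for n
  proof -
    have "t n - t (Suc n) / r \<le> cmod (of_real (t n) - of_real (t (Suc n)) / z)"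
      using norm_triangle_ineq2[of "of_real (t n)" "of_real (t (Suc n)) / z"] t0
      by (simp add: norm_divide z)
    hence "w n * (t n - t (Suc n) / r) \<le> w n * cmod (of_real (t n) - of_real (t (Suc n)) / z)"
      using w_pos[of n] by (intro mult_left_mono) auto
    also have "\<dots> = r * (d n * cmod (fps_nth (fps_delta G) n))"
      unfolding delta norm_divide norm_minus_cancel norm_power z w_def using r0 by simp
    finally have 1: "w n * (t n - t (Suc n) / r) \<le> r * (d n * cmod (fps_nth (fps_delta G) n))" .
    have "w n \<le> r * w (Suc n)"
      using r0 monoD[OF d_mono, of n "Suc n"] by (simp add: w_def field_simps)
    hence "w n * s (Suc n) \<le> r * w (Suc n) * s (Suc n)" by (rule mult_right_mono[OF _ s(1)])
    hence "w n * s (Suc n) / r \<le> w (Suc n) * s (Suc n)"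
      using r0 by (simp add: field_simps)
    moreover have "w n * t n * (1 - 1 / r) = w n * (t n - t (Suc n) / r) + w n * s (Suc n) / r"
      using r0 by (simp add: t_Suc field_simps)
    ultimately show ?thesis using 1 by linarith
  qed
  have S: "summable (\<lambda>n. r * (d n * cmod (fps_nth (fps_delta G) n)) + w (Suc n) * s (Suc n))"
    using G(1) s(2) unfolding H_iff
    by (intro summable_add summable_mult) (auto simp: summable_Suc_iff[of "\<lambda>n. w n * s n"])
  have nonneg: "0 \<le> w n * t n * (1 - 1 / r)" for n
    using w_pos[of n] t0[of n] r by simp
  have "summable (\<lambda>n. w n * t n * (1 - 1 / r))"
  proof (rule summable_comparison_test'[OF S])
    show "norm (w n * t n * (1 - 1 / r))
        \<le> r * (d n * cmod (fps_nth (fps_delta G) n)) + w (Suc n) * s (Suc n)" for n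
      unfolding real_norm_def abs_of_nonneg[OF nonneg] by (rule le)
  qed
  hence "summable (\<lambda>n. w n * t n * (1 - 1 / r) * (r / (r - 1)))" by (rule summable_mult2)
  moreover have "w n * t n * (1 - 1 / r) * (r / (r - 1)) = w n * t n" for n
    using r by (simp add: field_simps)
  ultimately have "summable (\<lambda>n. w n * t n)" by (simp only:)
  thus False using s(3) by (simp add: t_def)
qed

text \<open>By compactness of the closed disc, \<open>B\<close> has no zeros in some larger disc
  either, so \<open>inverse B\<close> again has radius of convergence above \<open>r\<close> and
  maps the space into itself.\<close>

lemma onto_if_no_zeros:
  assumes B: "fps_conv_radius B > ereal r" and nz: "\<And>z. cmod z \<le> r \<Longrightarrow> eval_fps B z \<noteq> 0"
  shows "onto B"
proof -
  define U where "U = eball 0 (fps_conv_radius B) \<inter> eval_fps B -` (- {0})"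
  have oU: "open U" unfolding U_def
    by (intro continuous_open_preimage continuous_on_eval_fps) auto
  have cU: "cball 0 r \<subseteq> U"
  proof
    fix z :: complex assume "z \<in> cball 0 r"
    hence z: "cmod z \<le> r" by simp
    hence "ereal (cmod z) < fps_conv_radius B" using B by (meson ereal_less_eq(3) le_less_trans)
    thus "z \<in> U" using nz[OF z] by (simp add: U_def)
  qed
  have "0 \<le> r" using r_ge_1 by simp
  obtain R where R: "R > r" "ball 0 R \<subseteq> U"
    by (rule cball_0_subset_open[OF oU cU \<open>0 \<le> r\<close>])
  have "eval_fps B z \<noteq> 0" if "ereal (cmod z) < ereal R" for z
  proof -
    have "z \<in> ball 0 R" using that by simp
    hence "z \<in> U" using R(2) by blast
    thus ?thesis by (simp add: U_def)
  qed
  hence le: "min (ereal R) (fps_conv_radius B) \<le> fps_conv_radius (inverse B)"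
    by (rule fps_conv_radius_inverse)
  have inv: "ereal r < fps_conv_radius (inverse B)"
    by (rule less_le_trans[OF _ le]) (use R B in simp)
  have "fps_nth B 0 \<noteq> 0" using nz[of 0] r_ge_1 by (simp add: eval_fps_at_0)
  hence unit: "B * inverse B = 1" by (rule inverse_mult_eq_1')
  show ?thesis unfolding onto_def
  proof
    fix F assume "F \<in> H"
    hence "inverse B * F \<in> H" by (rule mult_in_H[OF inv])
    moreover have "B * (inverse B * F) = F"
      by (simp only: mult.assoc[symmetric] unit mult_1_left)
    ultimately show "\<exists>G\<in>H. B * G = F" by (rule bexI[rotated])
  qed
qed

section \<open>Splitting off the zeros in the closed disc\<close>

lemma finite_zeros:
  assumes "fps_conv_radius B > ereal r" "B \<noteq> 0"
  shows "finite {z. cmod z \<le> r \<and> eval_fps B z = 0}"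
\<comment> \<open>The theorem on zeros needs a nonconstant function; a series without zeros in the
  disc may be constant and is treated apart.\<close>
proof (cases "{z. cmod z \<le> r \<and> eval_fps B z = 0} = {}")
  case False
  then obtain z0 where z0: "cmod z0 \<le> r" "eval_fps B z0 = 0" by blast
  obtain R where R: "ereal r < ereal R" "ereal R < fps_conv_radius B"
    using ereal_dense2[OF assms(1)] by auto
  have "R > 0" using R r_ge_1 by simp
  then obtain v where v: "v \<in> ball 0 R" "eval_fps B v \<noteq> 0"
    by (rule eval_fps_nonzero[OF assms(2) less_imp_le[OF R(2)]])
  have hol: "eval_fps B holomorphic_on ball 0 R"
    using R by (intro holomorphic_on_eval_fps ball_eball_mono) auto
  have "\<not> eval_fps B constant_on ball 0 R"
  proof
    assume "eval_fps B constant_on ball 0 R"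
    moreover have "z0 \<in> ball 0 R" using z0 R by simp
    ultimately show False using v z0(2) unfolding constant_on_def by metis
  qed
  moreover have "cball 0 r \<subseteq> ball 0 R" using R by auto
  ultimately have "finite {z \<in> cball 0 r. eval_fps B z = 0}"
    by (intro holomorphic_compact_finite_zeros[OF hol]) auto
  thus ?thesis by simp
next
  case True
  show ?thesis unfolding True by simp
qed

text \<open>The full multiplicity is removed, so that \<open>z\<close> is no zero of
  \<open>C\<close> and the number of zeros drops by one; \<open>Suc n\<close> records that at least
  one factor is split off.\<close>

lemma factor_zero:
  assumes B: "fps_conv_radius B > ereal r" "B \<noteq> 0" and z: "cmod z \<le> r" "eval_fps B z = 0"
  obtains n C where "B = (fps_X - fps_const z) ^ Suc n * C" "fps_conv_radius C > ereal r" "C \<noteq> 0"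
    "{u. cmod u \<le> r \<and> eval_fps C u = 0} = {u. cmod u \<le> r \<and> eval_fps B u = 0} - {z}"
proof -
  obtain R where R: "ereal r < ereal R" "ereal R < fps_conv_radius B"
    using ereal_dense2[OF B(1)] by auto
  have zR: "cmod z < R" using z R by simp
  obtain C n where C: "n > 0" "B = (fps_X - fps_const z) ^ n * C" 
      "ereal R \<le> fps_conv_radius C" "eval_fps C z \<noteq> 0"
      "\<forall>u. cmod u < R \<longrightarrow> eval_fps B u = (u - z) ^ n * eval_fps C u"
    by (rule eval_fps_factor_zero[OF B(2) less_imp_le[OF R(2)] zR z(2)])
  have "fps_conv_radius C > ereal r" using R(1) C(3) by (rule less_le_trans)
  moreover have "C \<noteq> 0" using C(2) B(2) by auto
  moreover have "eval_fps C u = 0 \<longleftrightarrow> eval_fps B u = 0 \<and> u \<noteq> z" if "cmod u \<le> r" for u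
    using C(1,4) C(5)[rule_format, of u] that R(1) by auto
  hence "{u. cmod u \<le> r \<and> eval_fps C u = 0} = {u. cmod u \<le> r \<and> eval_fps B u = 0} - {z}" by auto
  moreover obtain m where "n = Suc m" using C(1) by (cases n) auto
  ultimately show ?thesis using that C(2) by blast
qed

text \<open>Induction on the number of distinct zeros in the closed disc; without zeros the
  multiplication is even onto.\<close>

lemma dense_range_if_zeros_irregular:
  assumes "fps_conv_radius B > ereal r" "B \<noteq> 0"
    and "\<And>z. cmod z \<le> r \<Longrightarrow> eval_fps B z = 0 \<Longrightarrow> \<not> regular_point z"
  shows "dense_range B"
  using assms
proof (induction "card {z. cmod z \<le> r \<and> eval_fps B z = 0}" arbitrary: B)
  case 0
  hence "{z. cmod z \<le> r \<and> eval_fps B z = 0} = {}" using finite_zeros[of B] by simp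
  hence "onto B" using 0 by (intro onto_if_no_zeros) auto
  thus ?case by (rule onto_imp_dense_range)
next
  case (Suc k)
  let ?Z = "\<lambda>B. {z. cmod z \<le> r \<and> eval_fps B z = 0}"
  have "?Z B \<noteq> {}" using Suc.hyps(2) by (metis Zero_not_Suc card.empty)
  then obtain z where z: "cmod z \<le> r" "eval_fps B z = 0" by blast
  obtain C n where C: "B = (fps_X - fps_const z) ^ Suc n * C" "fps_conv_radius C > ereal r" "C \<noteq> 0"
    "?Z C = ?Z B - {z}"
    by (rule factor_zero[OF Suc.prems(1,2) z])
  have "z \<in> ?Z B" using z by simp
  hence "k = card (?Z C)"
    unfolding C(4) using Suc.hyps(2) by simp
  moreover have "\<not> regular_point u" if "cmod u \<le> r" "eval_fps C u = 0" for u
  proof -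
    have "u \<in> ?Z B - {z}" unfolding C(4)[symmetric] using that by simp
    thus ?thesis using Suc.prems(3) by simp
  qed
  ultimately have "dense_range C" using Suc.hyps(1) C(2,3) by blast
  moreover have "dense_range ((fps_X - fps_const z) ^ Suc n)"
    by (rule dense_range_power[OF dense_range_linear linear_radius]) (rule Suc.prems(3)[OF z])
  moreover have "fps_conv_radius ((fps_X - fps_const z) ^ Suc n) > ereal r"
    by (rule less_le_trans[OF linear_radius fps_conv_radius_power])
  ultimately show ?case unfolding C(1) using C(2) by (intro dense_range_mult)
qed

text \<open>A regular zero spoils density; an irregular zero spoils surjectivity, since a product
  can be onto only if its factor X - z is. \<open>irr\<close> is a hypothesis here because its
  proofs for r = 1 and r > 1 differ.\<close>

lemma dense_not_onto_iff:
  assumes B: "fps_conv_radius B > ereal r" "B \<noteq> 0"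
    and irr: "\<And>z. cmod z \<le> r \<Longrightarrow> \<not> regular_point z \<Longrightarrow> \<not> onto (fps_X - fps_const z)"
  shows "dense_range B \<and> \<not> onto B \<longleftrightarrow>
    (\<exists>z. cmod z \<le> r \<and> eval_fps B z = 0) \<and>
    (\<forall>z. cmod z \<le> r \<and> eval_fps B z = 0 \<longrightarrow> \<not> regular_point z)"
proof (intro iffI conjI)
  assume *: "dense_range B \<and> \<not> onto B"
  show "\<exists>z. cmod z \<le> r \<and> eval_fps B z = 0" using * onto_if_no_zeros[OF B(1)] by blast
  show "\<forall>z. cmod z \<le> r \<and> eval_fps B z = 0 \<longrightarrow> \<not> regular_point z"
    using * not_dense_range B(1) by blast
next
  assume *: "(\<exists>z. cmod z \<le> r \<and> eval_fps B z = 0) \<and>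
    (\<forall>z. cmod z \<le> r \<and> eval_fps B z = 0 \<longrightarrow> \<not> regular_point z)"
  show "dense_range B" using * by (intro dense_range_if_zeros_irregular B) auto
  obtain z where z: "cmod z \<le> r" "eval_fps B z = 0" using * by blast
  obtain C n where C: "B = (fps_X - fps_const z) ^ Suc n * C" "fps_conv_radius C > ereal r"
    using factor_zero[OF B z] by blast
  have rad: "fps_conv_radius ((fps_X - fps_const z) ^ n) > ereal r"
    by (rule less_le_trans[OF linear_radius fps_conv_radius_power])
  have "B = (fps_X - fps_const z) * ((fps_X - fps_const z) ^ n * C)"
    using C(1) by (simp add: mult.assoc)
  hence "onto B \<Longrightarrow> onto (fps_X - fps_const z)"
    using onto_mult_left radius_mult[OF rad C(2)] by metis
  thus "\<not> onto B" using irr z * by blast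
qed

section \<open>Determination of the regular points\<close>

lemma regular_point_unit_disc:
  assumes "cmod z \<le> 1" "z \<noteq> 1"
  shows "regular_point z"
proof -
  \<comment> \<open>The geometric sums are bounded, and \<open>d n\<close> is bounded below by
    \<open>d 0\<close>.\<close>
  have "cmod (\<Sum>k\<le>n. z ^ k) \<le> (2 / cmod (z - 1) / d 0) * d n" for n
  proof -
    have "cmod (z ^ Suc n - 1) \<le> cmod z ^ Suc n + 1"
      using norm_triangle_ineq4[of "z ^ Suc n" 1] by (simp add: norm_power norm_mult)
    also have "\<dots> \<le> 2" using power_le_one[of "cmod z" "Suc n"] assms(1) by simp
    finally have "cmod (z ^ Suc n - 1) \<le> 2" .
    hence "cmod (\<Sum>k\<le>n. z ^ k) \<le> 2 / cmod (z - 1)"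
      using geometric_sum[OF assms(2), of "Suc n"]
      by (simp only: lessThan_Suc_atMost norm_divide) (intro divide_right_mono, auto)
    also have "\<dots> = 2 / cmod (z - 1) * 1" by simp
    also have "\<dots> \<le> 2 / cmod (z - 1) * (d n / d 0)"
      using monoD[OF d_mono, of 0 n] d_pos[of 0] by (intro mult_left_mono) auto
    finally show ?thesis by (simp add: mult_ac)
  qed
  thus ?thesis unfolding regular_point_def by blast
qed

lemma regular_point_1: "regular_point 1 \<longleftrightarrow> bdd_above (range (\<lambda>n. real (n + 1) / d n))"
proof -
  have "cmod (\<Sum>k\<le>n. 1 ^ k) \<le> K * d n \<longleftrightarrow> real (n + 1) / d n \<le> K" for K n
    using d_pos[of n] norm_of_nat[of "Suc n", where 'a=complex] 
    by (simp add: field_simps del: norm_of_nat)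
  thus ?thesis unfolding regular_point_def bdd_above_def by simp
qed

text \<open>For \<open>q\<close> between \<open>max 1 (cmod z)\<close> and \<open>r\<close> the
  geometric sums are O(q^n), and q^n is O(\<open>d n\<close>) by the ratio test, with an
  intermediate \<open>p\<close> bounding the ratios of \<open>d\<close> from below.\<close>

lemma regular_point_interior:
  assumes "r > 1" "cmod z < r"
  shows "regular_point z"
proof -
  obtain q where q: "max 1 (cmod z) < q" "q < r" using dense[of "max 1 (cmod z)" r] assms by auto
  obtain p where p: "q < p" "p < r" using dense[OF q(2)] by auto
  have "\<forall>\<^sub>F n in sequentially. p < d (Suc n) / d n" using d_ratio p(2) by (rule order_tendstoD)
  then obtain m where m: "\<And>n. n \<ge> m \<Longrightarrow> p < d (Suc n) / d n"
    by (auto simp: eventually_at_top_linorder)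
  have "summable (\<lambda>n. q ^ n / d n)"
  proof (rule summable_ratio_test)
    show "q / p < 1" using p q by simp
    fix n assume "n \<ge> m"
    hence "p * d n \<le> d (Suc n)" using m[of n] d_pos[of n] by (simp add: field_simps)
    hence "q ^ Suc n / d (Suc n) \<le> q ^ Suc n / (p * d n)"
      using q p d_pos[of n] by (intro divide_left_mono) (auto simp: d_pos)
    thus "norm (q ^ Suc n / d (Suc n)) \<le> q / p * norm (q ^ n / d n)"
      using q d_pos by (simp add: less_imp_le abs_mult)
  qed
  hence "Bseq (\<lambda>n. q ^ n / d n)"
    by (rule convergent_imp_Bseq[OF convergentI[OF summable_LIMSEQ_zero]])
  then obtain K where K: "\<And>n. norm (q ^ n / d n) \<le> K"
    by (auto simp: Bseq_def)
  have "cmod (\<Sum>k\<le>n. z ^ k) \<le> (q / (q - 1) * K) * d n" for n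
  proof -
    have "cmod (\<Sum>k\<le>n. z ^ k) \<le> (\<Sum>k\<le>n. cmod z ^ k)"
      by (rule order_trans[OF norm_sum]) (simp add: norm_power)
    also have "\<dots> \<le> (\<Sum>k\<le>n. q ^ k)" using q by (intro sum_mono power_mono) auto
    also have "\<dots> = (q ^ Suc n - 1) / (q - 1)"
      using geometric_sum[of q "Suc n"] q by (simp only: lessThan_Suc_atMost)
    also have "\<dots> \<le> q ^ Suc n / (q - 1)" using q by (intro divide_right_mono) auto
    also have "\<dots> = q / (q - 1) * q ^ n" by simp
    also have "\<dots> \<le> q / (q - 1) * (K * d n)"
    proof (rule mult_left_mono)
      show "q ^ n \<le> K * d n" using K[of n] q d_pos[of n] by (simp add: field_simps)
    qed (use q in auto)
    finally show ?thesis by (simp add: mult_ac)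
  qed
  thus ?thesis unfolding regular_point_def by blast
qed

text \<open>As r > 1, the modulus of \<open>z ^ Suc n - 1\<close> is comparable to
  \<open>r ^ n\<close>: it lies between \<open>r ^ n * (r - 1)\<close> and
  \<open>2 * r * r ^ n\<close>.\<close>

lemma regular_point_circle:
  assumes r: "r > 1" and z: "cmod z = r"
  shows "regular_point z \<longleftrightarrow> bdd_above (range (\<lambda>n. r ^ n / d n))"
proof -
  have z1: "z \<noteq> 1" "cmod (z - 1) > 0" using r z by auto
  have sum: "cmod (\<Sum>k\<le>n. z ^ k) = cmod (z ^ Suc n - 1) / cmod (z - 1)" for n
    using geometric_sum[OF z1(1), of "Suc n"] by (simp only: lessThan_Suc_atMost norm_divide)
  show ?thesis
  proof
    assume "regular_point z"
    then obtain K where K: "\<And>n. cmod (\<Sum>k\<le>n. z ^ k) \<le> K * d n"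
      unfolding regular_point_def by blast
    have "r ^ n / d n \<le> K * cmod (z - 1) / (r - 1)" for n
    proof -
      have "r ^ n * (r - 1) \<le> r ^ Suc n - 1" using one_le_power[of r n] r by (simp add: algebra_simps)
      also have "\<dots> \<le> cmod (z ^ Suc n - 1)"
        using norm_triangle_ineq2[of "z ^ Suc n" 1] by (simp add: norm_power norm_mult z)
      also have "\<dots> \<le> K * d n * cmod (z - 1)" using K[of n] z1 unfolding sum by (simp add: field_simps)
      finally show ?thesis using r d_pos[of n] by (simp add: field_simps)
    qed
    thus "bdd_above (range (\<lambda>n. r ^ n / d n))" by (intro bdd_aboveI2)
  next
    assume "bdd_above (range (\<lambda>n. r ^ n / d n))"
    then obtain K where K: "\<And>n. r ^ n / d n \<le> K" by (auto simp: bdd_above_def)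
    have "cmod (\<Sum>k\<le>n. z ^ k) \<le> (2 * r * K / cmod (z - 1)) * d n" for n
    proof -
      have "cmod (z ^ Suc n - 1) \<le> r ^ Suc n + 1"
        using norm_triangle_ineq4[of "z ^ Suc n" 1] by (simp add: norm_power norm_mult z)
      also have "\<dots> \<le> 2 * r * r ^ n" using one_le_power[of r "Suc n"] r by simp
      also have "\<dots> \<le> 2 * r * (K * d n)"
        using K[of n] d_pos[of n] r by (intro mult_left_mono) (auto simp: field_simps)
      finally show ?thesis unfolding sum using z1 by (simp add: field_simps)
    qed
    thus "regular_point z" unfolding regular_point_def by blast
  qed
qed

end

section \<open>Return from power series to sequences\<close>

lemma fps_conv_radius_Abs_fps_beyond:
  assumes "gen_fun_analytic_near a (cball 0 \<rho>)" "\<rho> \<ge> 0"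
  shows "fps_conv_radius (Abs_fps a) > ereal \<rho>"
proof -
  obtain U where "open U \<and> cball 0 \<rho> \<subseteq> U \<and> (\<forall>z\<in>U. summable (\<lambda>n. a n * z ^ n)) \<and> gen_fun a analytic_on U"
    using assms(1) unfolding gen_fun_analytic_near_def by (elim exE)
  hence U: "open U" "cball 0 \<rho> \<subseteq> U" "\<And>z. z \<in> U \<Longrightarrow> summable (\<lambda>n. a n * z ^ n)"
    by simp_all
  obtain R where R: "R > \<rho>" "ball 0 R \<subseteq> U"
    by (rule cball_0_subset_open[OF U(1,2) assms(2)])
  obtain q where q: "\<rho> < q" "q < R" using dense[OF R(1)] by auto
  \<comment> \<open>Convergence at one point of modulus above \<open>\<rho>\<close>
    suffices.\<close>
  have "complex_of_real q \<in> U" using R q assms(2) by auto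
  from conv_radius_geI[OF U(3)[OF this]] have "ereal q \<le> fps_conv_radius (Abs_fps a)"
    unfolding norm_of_real using q assms(2) by (simp add: fps_conv_radius_def)
  moreover have "ereal \<rho> < ereal q" using q by simp
  ultimately show ?thesis by (rule less_le_trans[rotated])
qed

text \<open>The shifted operator is multiplication by \<open>B\<close>. It is injective for every
  \<open>c\<close>, since power series form an integral domain; density and surjectivity are decided
  by \<open>dense_not_onto_iff\<close>.\<close>

lemma (in hahn_weight) continuous_spectrum_conv_op_iff:
  assumes rad: "fps_conv_radius (Abs_fps a) > ereal r" and a1: "a 1 \<noteq> 0"
    and irr: "\<And>z. cmod z \<le> r \<Longrightarrow> \<not> regular_point z \<Longrightarrow> \<not> onto (fps_X - fps_const z)"
  shows "c \<in> continuous_spectrum (hahn_space d) (hahn_norm d) (conv_op a) \<longleftrightarrow>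
    (\<exists>z. cmod z \<le> r \<and> gen_fun a z = c) \<and>
    (\<forall>z. cmod z \<le> r \<and> gen_fun a z = c \<longrightarrow> \<not> regular_point z)"
proof -
  define B where "B = Abs_fps a - fps_const c"
  let ?X = "hahn_space d" and ?T = "shifted_op (conv_op a) c"
  \<comment> \<open>Subtracting a constant only affects the coefficient 0, so \<open>a 1\<close>
    keeps \<open>B\<close> nonzero for every \<open>c\<close>.\<close>
  have "fps_nth B 1 \<noteq> 0" using a1 by (simp add: B_def)
  hence B0: "B \<noteq> 0" by auto
  have radB: "fps_conv_radius B > ereal r"
    unfolding B_def by (rule less_le_trans[OF _ fps_conv_radius_diff]) (use rad in simp)
  have X: "x \<in> ?X \<longleftrightarrow> Abs_fps x \<in> H" for x by (simp add: H_def fps_nth_Abs_fps[abs_def])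
  have op: "?T x = fps_nth (B * Abs_fps x)" for x
  proof
    fix n
    have "fps_nth (Abs_fps a * Abs_fps x) n = conv_op a x n"
      unfolding mult.commute[of "Abs_fps a"] fps_mult_nth conv_op_def by (simp add: mult.commute)
    thus "?T x n = fps_nth (B * Abs_fps x) n" by (simp add: B_def shifted_op_def left_diff_distrib)
  qed
  have TX: "?T x \<in> ?X" if "x \<in> ?X" for x
    \<comment> \<open>\<open>fps_nth_inverse\<close> is the type isomorphism
      \<open>Abs_fps (fps_nth F) = F\<close>, not the reciprocal of a series.\<close>
    using mult_in_H[OF radB, of "Abs_fps x"] that unfolding op X by (simp only: fps_nth_inverse)
  have image: "?T ` ?X = {fps_nth (B * G) |G. G \<in> H}"
  proof safe
    fix x assume "x \<in> ?X"
    thus "\<exists>G. ?T x = fps_nth (B * G) \<and> G \<in> H" using X op by blast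
  next
    fix G assume "G \<in> H"
    thus "fps_nth (B * G) \<in> ?T ` ?X"
      by (intro image_eqI[of _ _ "fps_nth G"]) (auto simp: op fps_nth_inverse H_def)
  qed
  have inj: "inj_on ?T ?X"
  proof (rule inj_onI)
    fix x y assume "?T x = ?T y"
    hence "B * Abs_fps x = B * Abs_fps y" unfolding op by (simp add: fps_nth_inject)
    hence "Abs_fps x = Abs_fps y" using B0 by simp
    thus "x = y" by (metis fps_nth_Abs_fps ext)
  qed
  have dense: "dense_in ?X (hahn_norm d) (?T ` ?X) \<longleftrightarrow> dense_range B"
  proof -
    have sub: "?T ` ?X \<subseteq> ?X" using TX by blast
    have Nd: "hahn_norm d (\<lambda>n. x n - fps_nth (B * G) n) = N (Abs_fps x - B * G)" for x G
      unfolding N_def by (simp add: fps_sub_nth[abs_def])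
    have "dense_in ?X (hahn_norm d) (?T ` ?X) \<longleftrightarrow>
        (\<forall>x\<in>?X. \<forall>e>0. \<exists>G\<in>H. N (Abs_fps x - B * G) < e)"
    proof -
      have "(\<exists>y\<in>?T ` ?X. hahn_norm d (\<lambda>n. x n - y n) < e) \<longleftrightarrow> (\<exists>G\<in>H. N (Abs_fps x - B * G) < e)" for x e
        unfolding image Nd[symmetric] by blast
      thus ?thesis unfolding dense_in_def using sub by simp
    qed
    also have "\<dots> \<longleftrightarrow> dense_range B"
      unfolding dense_range_def
      by (metis (mono_tags, lifting) H_def X fps_nth_inverse mem_Collect_eq)
    finally show ?thesis .
  qed
  have onto: "?T ` ?X = ?X \<longleftrightarrow> onto B"
  proof
    assume eq: "?T ` ?X = ?X"
    show "onto B" unfolding onto_def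
    proof
      fix F assume "F \<in> H"
      hence "fps_nth F \<in> ?T ` ?X" unfolding eq by (simp add: H_def)
      then obtain G where "G \<in> H" "fps_nth F = fps_nth (B * G)" unfolding image by blast
      thus "\<exists>G\<in>H. B * G = F" by (metis fps_nth_inject)
    qed
  next
    assume onto: "onto B"
    have "x \<in> ?T ` ?X" if x: "x \<in> ?X" for x
    proof -
      obtain G where "G \<in> H" "B * G = Abs_fps x" using onto x unfolding onto_def X by blast
      moreover have "x = fps_nth (Abs_fps x)" by (simp add: fun_eq_iff)
      ultimately show ?thesis unfolding image by (metis (mono_tags, lifting) mem_Collect_eq)
    qed
    thus "?T ` ?X = ?X" using TX by blast
  qed
  have "eval_fps B z = gen_fun a z - c" if "cmod z \<le> r" for z
  proof -
    have "ereal (cmod z) < fps_conv_radius (Abs_fps a)"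
      using that rad by (meson ereal_less_eq(3) le_less_trans)
    hence "eval_fps B z = eval_fps (Abs_fps a) z - c" unfolding B_def by (subst eval_fps_diff) auto
    thus ?thesis by (simp add: eval_fps_def gen_fun_def)
  qed
  hence zero: "cmod z \<le> r \<and> eval_fps B z = 0 \<longleftrightarrow> cmod z \<le> r \<and> gen_fun a z = c" for z by auto
  have "c \<in> continuous_spectrum ?X (hahn_norm d) (conv_op a) \<longleftrightarrow> dense_range B \<and> \<not> onto B"
    unfolding continuous_spectrum_def using inj dense onto by simp
  also have "\<dots> \<longleftrightarrow> (\<exists>z. cmod z \<le> r \<and> eval_fps B z = 0) \<and>
    (\<forall>z. cmod z \<le> r \<and> eval_fps B z = 0 \<longrightarrow> \<not> regular_point z)"
    by (rule dense_not_onto_iff[OF radB B0 irr])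
  finally show ?thesis unfolding zero .
qed

theorem corollary6p7:
  fixes d :: "nat \<Rightarrow> real" and r :: real and a :: "nat \<Rightarrow> complex"
  assumes d_pos: "\<And>n. d n > 0"
    and d_mono: "mono d"
    and d_unbounded: "\<not> bdd_above (range d)"
    and d_ratio: "(\<lambda>n. d (Suc n) / d n) \<longlonglongrightarrow> r"
    and a_0: "a 0 \<noteq> 0"
    and a_1: "a 1 \<noteq> 0"
    and T_bounded: "bounded_operator_on (hahn_space d) (hahn_norm d) (conv_op a)"
    and analytic: "gen_fun_analytic_near a (cball 0 r)"
  shows "(r = 1 \<longrightarrow>
           continuous_spectrum (hahn_space d) (hahn_norm d) (conv_op a) =
             (if bdd_above (range (\<lambda>n. real (n + 1) / d n)) then {}
              else gen_fun a ` cball 0 1 - gen_fun a ` (cball 0 1 - {1}))) \<and>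
         (r > 1 \<longrightarrow>
           continuous_spectrum (hahn_space d) (hahn_norm d) (conv_op a) =
             (if bdd_above (range (\<lambda>n. r ^ n / d n)) then {}
              else gen_fun a ` cball 0 r - gen_fun a ` ball 0 r))"
proof -
  interpret hahn_weight d r using d_pos d_mono d_ratio by unfold_locales
  have rad: "fps_conv_radius (Abs_fps a) > ereal r"
    using fps_conv_radius_Abs_fps_beyond[OF analytic] r_ge_1 by simp
  let ?S = "continuous_spectrum (hahn_space d) (hahn_norm d) (conv_op a)"
  show ?thesis
  proof (intro conjI impI)
    assume r: "r = 1"
    \<comment> \<open>In the closed unit disc, 1 is the only point that can be irregular.\<close>
    have reg: "regular_point z \<longleftrightarrow> z \<noteq> 1 \<or> bdd_above (range (\<lambda>n. real (n + 1) / d n))"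
      if "cmod z \<le> 1" for z
      using regular_point_unit_disc[OF that] regular_point_1 by (cases "z = 1") auto
    have "\<not> onto (fps_X - fps_const z)" if "cmod z \<le> r" "\<not> regular_point z" for z
      using reg[of z] not_onto_at_1[OF r] that r by auto
    hence iff: "c \<in> ?S \<longleftrightarrow> (\<exists>z. cmod z \<le> r \<and> gen_fun a z = c) \<and>
        (\<forall>z. cmod z \<le> r \<and> gen_fun a z = c \<longrightarrow> \<not> regular_point z)" for c
      by (intro continuous_spectrum_conv_op_iff rad a_1)
    \<comment> \<open>If the quotients are bounded, all points of the disc are regular and the two
      conditions in \<open>iff\<close> exclude each other; otherwise they say that \<open>c\<close>
      is attained in the disc, but only at 1.\<close>
    show "?S = (if bdd_above (range (\<lambda>n. real (n + 1) / d n)) then {}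
              else gen_fun a ` cball 0 1 - gen_fun a ` (cball 0 1 - {1}))"
    proof (rule set_eqI)
      fix c
      show "c \<in> ?S \<longleftrightarrow> c \<in> (if bdd_above (range (\<lambda>n. real (n + 1) / d n)) then {}
              else gen_fun a ` cball 0 1 - gen_fun a ` (cball 0 1 - {1}))"
        unfolding iff using reg r by (auto simp: image_iff) (metis DiffI mem_cball_0 singletonD)
    qed
  next
    assume r: "r > 1"
    \<comment> \<open>Irregular points can only lie on the circle of radius \<open>r\<close>, and
      there all points are of the same type.\<close>
    have reg: "regular_point z \<longleftrightarrow> cmod z < r \<or> bdd_above (range (\<lambda>n. r ^ n / d n))"
      if "cmod z \<le> r" for z
      using that regular_point_interior[OF r, of z] regular_point_circle[OF r, of z]
      by (cases "cmod z = r") auto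
    have "\<not> onto (fps_X - fps_const z)" if "cmod z \<le> r" "\<not> regular_point z" for z
      using reg[of z] not_onto_on_circle[OF r, of z] that by auto
    hence iff: "c \<in> ?S \<longleftrightarrow> (\<exists>z. cmod z \<le> r \<and> gen_fun a z = c) \<and>
        (\<forall>z. cmod z \<le> r \<and> gen_fun a z = c \<longrightarrow> \<not> regular_point z)" for c
      by (intro continuous_spectrum_conv_op_iff rad a_1)
    show "?S = (if bdd_above (range (\<lambda>n. r ^ n / d n)) then {}
              else gen_fun a ` cball 0 r - gen_fun a ` ball 0 r)"
    proof (rule set_eqI)
      fix c
      show "c \<in> ?S \<longleftrightarrow> c \<in> (if bdd_above (range (\<lambda>n. r ^ n / d n)) then {}
              else gen_fun a ` cball 0 r - gen_fun a ` ball 0 r)"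
        unfolding iff using reg by (auto simp: image_iff) (metis less_imp_le mem_ball_0)+
    qed
  qed
qed

end
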